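(* Let $R \in \mathbb{N}$ be a prime number and $k \in \mathbb{N}$. There is a reduction, running in time at most $\mathrm{poly}(|V|, |E|, R^k)$, that maps any $R$-degree bounded $k$-CSP instance $\Pi = (G=(V,E), R, \mathcal{C})$ with alphabet size $R$ to a $kR$-Set Packing instance such that, if $\psi^*$ is an optimal assignment of $\Pi$ and $M^*$ is a maximum matching of the constructed instance, then $|\mathcal{C}(\psi^* )| = |M^*|$. Moreover, if $\Pi$ is $k$-partite, the constructed instance is a $kR$-Dimensional Matching instance.
   Context: A $k$-CSP instance $\Pi = (G=(V,E), R, \mathcal{C})$ consists of a hypergraph $G=(V,E)$ whose hyperedges are (ordered) $k$-tuples of vertices, an alphabet $[R]=\{1,\dots,R\}$, and for each hyperedge $e=(u_1,\dots,u_k)\in E$ a constraint $\mathcal{C}_e \subseteq [R]^k$; $\mathcal{C}$ is the set of constraints, $|\mathcal{C}|=|E|$. An assignment is a map $\psi: V \to [R]$; $\mathcal{C}(\psi) = \{e \in E : \psi(e) \in \mathcal{C}_e\}$ is the set of constraints it satisfies, where $\psi(e) = (\psi(u_1),\dots,\psi(u_k))$. An optimal assignment maximizes $|\mathcal{C}(\psi)|$. $\Pi$ is $d$-degree bounded if every vertex lies in at most $d$ hyperedges, and $k$-partite if $V$ is partitioned into $V_1,\dots,V_k$ with every hyperedge containing exactly one vertex of each $V_i$. A $p$-Set Packing instance is a hypergraph with hyperedges of size at most $p$; it is a $p$-Dimensional Matching instance if it is $p$-partite (vertex set partitioned into $p$ parts, each hyperedge containing exactly one vertex of each part). A matching is a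 set of pairwise disjoint hyperedges. *)

theory Defs
  imports Complex_Main "HOL-Library.Disjoint_Sets" "HOL-Library.FuncSet"
    "HOL-Computational_Algebra.Primes"
begin

section \<open>Constraint satisfaction and set packing instances\<close>

text \<open>Hyperedges are tuples, represented as lists; a tuple may repeat a vertex. The component
  \<open>constr\<close> is only meaningful on hyperedges.\<close>

record 'v csp =
  verts :: "'v set"
  hedges :: "'v list set"
  alph :: nat
  constr :: "'v list \<Rightarrow> nat list set"

definition csp_instance :: "nat \<Rightarrow> 'v csp \<Rightarrow> bool" where
  "csp_instance k \<Phi> \<longleftrightarrow>
     finite (verts \<Phi>) \<and>
     (\<forall>e\<in>hedges \<Phi>. set e \<subseteq> verts \<Phi> \<and> length e = k) \<and>
     (\<forall>e\<in>hedges \<Phi>. constr \<Phi> e \<subseteq> {\<alpha>. set \<alpha> \<subseteq> {1..alph \<Phi>} \<and> length \<alpha> = k})"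

definition degree_bounded :: "nat \<Rightarrow> 'v csp \<Rightarrow> bool" where
  "degree_bounded d \<Phi> \<longleftrightarrow> (\<forall>v\<in>verts \<Phi>. card {e \<in> hedges \<Phi>. v \<in> set e} \<le> d)"

definition assignment :: "'v csp \<Rightarrow> ('v \<Rightarrow> nat) \<Rightarrow> bool" where
  "assignment \<Phi> \<psi> \<longleftrightarrow> \<psi> \<in> verts \<Phi> \<rightarrow> {1..alph \<Phi>}"

definition satisfied :: "'v csp \<Rightarrow> ('v \<Rightarrow> nat) \<Rightarrow> 'v list set" where
  "satisfied \<Phi> \<psi> = {e \<in> hedges \<Phi>. map \<psi> e \<in> constr \<Phi> e}"

definition optimal_assignment :: "'v csp \<Rightarrow> ('v \<Rightarrow> nat) \<Rightarrow> bool" where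
  "optimal_assignment \<Phi> \<psi> \<longleftrightarrow> is_arg_max (\<lambda>\<psi>. card (satisfied \<Phi> \<psi>)) (assignment \<Phi>) \<psi>"

text \<open>Parts are allowed to be empty.\<close>

definition partite :: "nat \<Rightarrow> 'a set \<Rightarrow> 'a set set \<Rightarrow> bool" where
  "partite p V F \<longleftrightarrow>
     (\<exists>part :: nat \<Rightarrow> 'a set. V = (\<Union>i<p. part i) \<and> disjoint_family_on part {..<p} \<and>
        (\<forall>e\<in>F. \<forall>i<p. \<exists>!v. v \<in> e \<and> v \<in> part i))"

definition partite_csp :: "nat \<Rightarrow> 'v csp \<Rightarrow> bool" where
  "partite_csp k \<Phi> \<longleftrightarrow> partite k (verts \<Phi>) (set ` hedges \<Phi>)"

type_synonym 'a hypergraph = "'a set \<times> 'a set set"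

definition set_packing_instance :: "nat \<Rightarrow> 'a hypergraph \<Rightarrow> bool" where
  "set_packing_instance p H \<longleftrightarrow>
     finite (fst H) \<and> (\<forall>h\<in>snd H. h \<subseteq> fst H \<and> card h \<le> p)"

definition dim_matching_instance :: "nat \<Rightarrow> 'a hypergraph \<Rightarrow> bool" where
  "dim_matching_instance p H \<longleftrightarrow> set_packing_instance p H \<and> partite p (fst H) (snd H)"

definition matching :: "'a hypergraph \<Rightarrow> 'a set set \<Rightarrow> bool" where
  "matching H M \<longleftrightarrow> M \<subseteq> snd H \<and> pairwise disjnt M"

definition maximum_matching :: "'a hypergraph \<Rightarrow> 'a set set \<Rightarrow> bool" where
  "maximum_matching H M \<longleftrightarrow> is_arg_max card (matching H) M"

section \<open>Machine model\<close>

text \<open>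
  Running time is measured on a random access machine with structured control flow. Memory
  consists of named, unbounded arrays of natural numbers (a scalar variable is cell 0 of an array).
  Every elementary operation has unit cost. The only arithmetic operations are addition and
  truncated subtraction; without multiplication, \<open>t\<close> steps lengthen numbers by \<open>O(t)\<close> bits only,
  so that unit-cost time is polynomially related to Turing machine time.
\<close>

type_synonym state = "string \<Rightarrow> nat \<Rightarrow> nat"

datatype aexp = Const nat | Read string aexp | Plus aexp aexp | Minus aexp aexp

datatype bexp = Less aexp aexp | Equal aexp aexp

datatype com =
    Skip
  | Write string aexp aexp
  | Seq com com
  | If bexp com com
  | While bexp com

fun aval :: "aexp \<Rightarrow> state \<Rightarrow> nat" where
  "aval (Const n) s = n"
| "aval (Read x a) s = s x (aval a s)"
| "aval (Plus a b) s = aval a s + aval b s"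
| "aval (Minus a b) s = aval a s - aval b s"

fun acost :: "aexp \<Rightarrow> nat" where
  "acost (Const n) = 1"
| "acost (Read x a) = acost a + 1"
| "acost (Plus a b) = acost a + acost b + 1"
| "acost (Minus a b) = acost a + acost b + 1"

fun bval :: "bexp \<Rightarrow> state \<Rightarrow> bool" where
  "bval (Less a b) s \<longleftrightarrow> aval a s < aval b s"
| "bval (Equal a b) s \<longleftrightarrow> aval a s = aval b s"

fun bcost :: "bexp \<Rightarrow> nat" where
  "bcost (Less a b) = acost a + acost b + 1"
| "bcost (Equal a b) = acost a + acost b + 1"

text \<open>\<open>exec c s t s'\<close>: started in state \<open>s\<close>, the program \<open>c\<close> terminates in state \<open>s'\<close> after
  exactly \<open>t\<close> steps.\<close>

inductive exec :: "com \<Rightarrow> state \<Rightarrow> nat \<Rightarrow> state \<Rightarrow> bool" where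
  Skip: "exec Skip s 1 s"
| Write: "exec (Write x i a) s (acost i + acost a + 1) (s(x := (s x)(aval i s := aval a s)))"
| Seq: "exec c\<^sub>1 s t\<^sub>1 s\<^sub>1 \<Longrightarrow> exec c\<^sub>2 s\<^sub>1 t\<^sub>2 s\<^sub>2 \<Longrightarrow> exec (Seq c\<^sub>1 c\<^sub>2) s (t\<^sub>1 + t\<^sub>2) s\<^sub>2"
| IfTrue: "bval b s \<Longrightarrow> exec c\<^sub>1 s t s' \<Longrightarrow> exec (If b c\<^sub>1 c\<^sub>2) s (bcost b + t) s'"
| IfFalse: "\<not> bval b s \<Longrightarrow> exec c\<^sub>2 s t s' \<Longrightarrow> exec (If b c\<^sub>1 c\<^sub>2) s (bcost b + t) s'"
| WhileFalse: "\<not> bval b s \<Longrightarrow> exec (While b c) s (bcost b) s"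
| WhileTrue: "bval b s \<Longrightarrow> exec c s t\<^sub>1 s\<^sub>1 \<Longrightarrow> exec (While b c) s\<^sub>1 t\<^sub>2 s\<^sub>2 \<Longrightarrow>
    exec (While b c) s (bcost b + t\<^sub>1 + t\<^sub>2) s\<^sub>2"

inductive_cases exec_elims:
  "exec Skip s t s'"
  "exec (Write x i a) s t s'"
  "exec (Seq c\<^sub>1 c\<^sub>2) s t s'"
  "exec (If b c\<^sub>1 c\<^sub>2) s t s'"
  "exec (While b c) s t s'"

lemma exec_deterministic:
  "exec c s t s' \<Longrightarrow> exec c s u r \<Longrightarrow> u = t \<and> r = s'"
proof (induction arbitrary: u r rule: exec.induct)
  case (Skip s)
  then show ?case by (elim exec_elims(1)) simp
next
  case (Write x i a s)
  then show ?case by (elim exec_elims(2)) simp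
next
  case (Seq c\<^sub>1 s t\<^sub>1 s\<^sub>1 c\<^sub>2 t\<^sub>2 s\<^sub>2)
  from Seq.prems show ?case by (rule exec_elims(3)) (use Seq.IH in blast)
next
  case (IfTrue b s c\<^sub>1 t s' c\<^sub>2)
  from IfTrue.prems show ?case by (rule exec_elims(4)) (use IfTrue.hyps IfTrue.IH in blast)+
next
  case (IfFalse b s c\<^sub>2 t s' c\<^sub>1)
  from IfFalse.prems show ?case by (rule exec_elims(4)) (use IfFalse.hyps IfFalse.IH in blast)+
next
  case (WhileFalse b s c)
  from WhileFalse.prems show ?case by (rule exec_elims(5)) (use WhileFalse.hyps in simp_all)
next
  case (WhileTrue b s c t\<^sub>1 s\<^sub>1 t\<^sub>2 s\<^sub>2)
  from WhileTrue.prems show ?case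
    by (rule exec_elims(5)) (use WhileTrue.hyps WhileTrue.IH in blast)+
qed

text \<open>A list is passed in an array as its length followed by its entries. All memory outside the
  input array is initially zero.\<close>

definition load :: "nat list \<Rightarrow> nat \<Rightarrow> nat" where
  "load xs i = (if i = 0 then length xs else if i \<le> length xs then xs ! (i - 1) else 0)"

definition stores :: "(nat \<Rightarrow> nat) \<Rightarrow> nat list \<Rightarrow> bool" where
  "stores a ys \<longleftrightarrow> a 0 = length ys \<and> (\<forall>i<length ys. a (Suc i) = ys ! i)"

definition computes :: "com \<Rightarrow> nat list \<Rightarrow> nat list \<Rightarrow> nat \<Rightarrow> bool" where
  "computes P xs ys t \<longleftrightarrow>
     (\<exists>s. exec P ((\<lambda>_ _. 0)(''in'' := load xs)) t s \<and> stores (s ''out'') ys)"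

section \<open>Encodings\<close>

text \<open>
  A CSP instance is presented with respect to a numbering \<open>\<nu>\<close> of its vertices by \<open>0, \<dots>, |V| - 1\<close>
  and a listing \<open>es\<close> of its hyperedges. Each hyperedge is written as its \<open>k\<close> vertex numbers followed
  by the truth table of its constraint, of length \<open>R\<close> to the power \<open>k\<close>; \<open>List.n_lists\<close> lists all
  tuples in \<open>[R]\<^sup>k\<close>, the first coordinate varying fastest.
\<close>

definition csp_presentation :: "('v \<Rightarrow> nat) \<Rightarrow> 'v list list \<Rightarrow> 'v csp \<Rightarrow> bool" where
  "csp_presentation \<nu> es \<Phi> \<longleftrightarrow>
     bij_betw \<nu> (verts \<Phi>) {..<card (verts \<Phi>)} \<and> distinct es \<and> set es = hedges \<Phi>"

definition truth_table :: "nat \<Rightarrow> nat \<Rightarrow> nat list set \<Rightarrow> nat list" where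
  "truth_table R k A = map (\<lambda>\<alpha>. if \<alpha> \<in> A then 1 else 0) (List.n_lists k [1..<Suc R])"

definition encode_csp :: "nat \<Rightarrow> ('v \<Rightarrow> nat) \<Rightarrow> 'v list list \<Rightarrow> 'v csp \<Rightarrow> nat list" where
  "encode_csp k \<nu> es \<Phi> =
     [alph \<Phi>, k, card (verts \<Phi>), length es] @
     concat (map (\<lambda>e. map \<nu> e @ truth_table (alph \<Phi>) k (constr \<Phi> e)) es)"

text \<open>The hypergraph with vertices \<open>0, \<dots>, n - 1\<close> and hyperedges listed in \<open>hs\<close> is written as a
  sequence of length-prefixed lists.\<close>

definition hypergraph_of :: "nat \<Rightarrow> nat list list \<Rightarrow> nat hypergraph" where
  "hypergraph_of n hs = ({..<n}, set ` set hs)"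

definition encode_hypergraph :: "nat \<Rightarrow> nat list list \<Rightarrow> nat list" where
  "encode_hypergraph n hs = [n, length hs] @ concat (map (\<lambda>h. length h # h) hs)"

end

theory Submission
  imports Defs "HOL-Number_Theory.Cong"
begin

text \<open>
  Give every vertex \<open>v\<close> of the CSP its own copy of the affine plane over the field with \<open>R\<close>
  elements, and number the at most \<open>R\<close> constraints containing \<open>v\<close> by \<open>0, \<dots>, R - 1\<close>. A pair of a
  constraint \<open>e\<close> and a satisfying tuple \<open>\<alpha>\<close> becomes the union, over the positions \<open>i\<close>, of the line
  \<open>y = \<alpha>\<^sub>i x + j\<close> in the plane of the \<open>i\<close>-th vertex of \<open>e\<close>, where \<open>j\<close> is the number of \<open>e\<close> at
  that vertex. Two lines of different slope always meet, while different lines of equal slope are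
  disjoint; hence two such sets are disjoint exactly if they come from different constraints and
  their tuples agree on all common vertices, and matchings correspond to partial assignments. If
  the CSP is \<open>k\<close>-partite, the part of the vertex together with the \<open>x\<close>-coordinate splits the points
  into \<open>kR\<close> parts, and every line has exactly one point for each \<open>x\<close>.

  Tuples that assign different values to two occurrences of one vertex are skipped. The case
  \<open>k = 0\<close> needs care because \<open>R\<close> may then exceed any time bound in terms of \<open>R\<^sup>k = 1\<close>; the
  program works with \<open>r = 0\<close> in place of \<open>R\<close>, which changes neither \<open>kR\<close> nor \<open>R\<^sup>k\<close>.
\<close>

section \<open>Total correctness and polynomial running time of structured programs\<close>

section \<open>Reasoning about programs\<close>

text \<open>An upper bound for the running time, provided that every execution of a loop makes at most
  \<open>L\<close> iterations. It depends on the program text only and is a polynomial in \<open>L\<close>.\<close>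

fun loop_bound :: "nat \<Rightarrow> com \<Rightarrow> nat" where
  "loop_bound L Skip = 1"
| "loop_bound L (Write x i a) = acost i + acost a + 1"
| "loop_bound L (Seq c1 c2) = loop_bound L c1 + loop_bound L c2"
| "loop_bound L (If b c1 c2) = bcost b + loop_bound L c1 + loop_bound L c2"
| "loop_bound L (While b c) = bcost b + L * (bcost b + loop_bound L c)"

text \<open>Powers of \<open>L\<close> grow with the exponent because \<open>1 \<le> L\<close>, so
  the sum of the two exponents serves as a common one.\<close>

lemma poly_bound_add:
  fixes f g :: "nat \<Rightarrow> nat"
  assumes "\<And>L. 1 \<le> L \<Longrightarrow> f L \<le> c * L ^ d" and "\<And>L. 1 \<le> L \<Longrightarrow> g L \<le> c' * L ^ d'" and "1 \<le> L"
  shows "f L + g L \<le> (c + c') * L ^ (d + d')"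
proof -
  have "L ^ d \<le> L ^ (d + d')" "L ^ d' \<le> L ^ (d + d')"
    using assms(3) by (auto intro: power_increasing)
  then have "c * L ^ d \<le> c * L ^ (d + d')" "c' * L ^ d' \<le> c' * L ^ (d + d')"
    by auto
  then show ?thesis
    using assms(1)[OF assms(3)] assms(2)[OF assms(3)] unfolding distrib_right by linarith
qed

text \<open>Induction on the program text: sequencing and branching add the bounds of their parts,
  while a loop multiplies the bound of its body by \<open>L\<close> and so raises the degree by
  one.\<close>

lemma loop_bound_polynomial:
  "\<exists>c d. \<forall>L\<ge>1. loop_bound L P \<le> c * L ^ d"
proof (induction P)
  case Skip
  show ?case by (rule exI[of _ 1], rule exI[of _ 0]) simp
next
  case (Write x i a)
  show ?case by (rule exI[of _ "acost i + acost a + 1"], rule exI[of _ 0]) simp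
next
  case (Seq P1 P2)
  then obtain c d c' d' where
    "\<And>L. 1 \<le> L \<Longrightarrow> loop_bound L P1 \<le> c * L ^ d" "\<And>L. 1 \<le> L \<Longrightarrow> loop_bound L P2 \<le> c' * L ^ d'"
    by blast
  from poly_bound_add[OF this] show ?case by (metis loop_bound.simps(3))
next
  case (If b P1 P2)
  then obtain c d c' d' where
    "\<And>L. 1 \<le> L \<Longrightarrow> loop_bound L P1 \<le> c * L ^ d" "\<And>L. 1 \<le> L \<Longrightarrow> loop_bound L P2 \<le> c' * L ^ d'"
    by blast
  note * = poly_bound_add[OF this]
  have "bcost b + (loop_bound L P1 + loop_bound L P2) \<le> (bcost b + (c + c')) * L ^ (0 + (d + d'))"
    if "1 \<le> L" for L
    by (rule poly_bound_add[where f = "\<lambda>_. bcost b"]) (use * that in auto)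
  then show ?case by (metis loop_bound.simps(4) add.assoc)
next
  case (While b P)
  then obtain c d where *: "\<And>L. 1 \<le> L \<Longrightarrow> loop_bound L P \<le> c * L ^ d"
    by blast
  have body: "bcost b + loop_bound L P \<le> (bcost b + c) * L ^ (0 + d)" if "1 \<le> L" for L
    by (rule poly_bound_add[where f = "\<lambda>_. bcost b"]) (use * that in auto)
  have "bcost b + L * (bcost b + loop_bound L P) \<le> (bcost b + (bcost b + c)) * L ^ (0 + Suc d)"
    if "1 \<le> L" for L
    by (rule poly_bound_add[where f = "\<lambda>_. bcost b"])
      (use body that in \<open>auto simp: mult.left_commute\<close>)
  then show ?case by (metis loop_bound.simps(5))
qed

text \<open>A total-correctness judgement that carries its own time bound. The bound is syntactic,
  so proofs about programs only limit loop counts by \<open>L\<close> and never add up running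
  times.\<close>

definition runs :: "nat \<Rightarrow> com \<Rightarrow> state \<Rightarrow> (state \<Rightarrow> bool) \<Rightarrow> bool" where
  "runs L c s Q \<longleftrightarrow> (\<exists>t s'. exec c s t s' \<and> t \<le> loop_bound L c \<and> Q s')"

lemma runs_mono:
  assumes "runs L c s Q" and "\<And>s'. Q s' \<Longrightarrow> Q' s'"
  shows "runs L c s Q'"
  using assms unfolding runs_def by blast

lemma runs_Skip: "Q s \<Longrightarrow> runs L Skip s Q"
  unfolding runs_def by (auto intro!: exI exec.Skip)

lemma runs_Write: "Q (s(x := (s x)(aval i s := aval a s))) \<Longrightarrow> runs L (Write x i a) s Q"
  unfolding runs_def by (intro exI conjI, rule exec.Write) auto

lemma runs_Seq:
  assumes "runs L c1 s (\<lambda>s'. runs L c2 s' Q)"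
  shows "runs L (Seq c1 c2) s Q"
  using assms unfolding runs_def by (fastforce intro: exec.Seq)

lemma runs_If:
  assumes "bval b s \<Longrightarrow> runs L c1 s Q" and "\<not> bval b s \<Longrightarrow> runs L c2 s Q"
  shows "runs L (If b c1 c2) s Q"
proof (cases "bval b s")
  case True
  with assms(1) obtain t s' where "exec c1 s t s'" "t \<le> loop_bound L c1" "Q s'"
    unfolding runs_def by blast
  with True show ?thesis
    unfolding runs_def by (intro exI[of _ "bcost b + t"] exI[of _ s']) (auto intro: exec.IfTrue)
next
  case False
  with assms(2) obtain t s' where "exec c2 s t s'" "t \<le> loop_bound L c2" "Q s'"
    unfolding runs_def by blast
  with False show ?thesis
    unfolding runs_def by (intro exI[of _ "bcost b + t"] exI[of _ s']) (auto intro: exec.IfFalse)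
qed

text \<open>The invariant is indexed by the number of finished iterations, and the loop makes
  exactly \<open>N\<close> of them; this one index yields both termination and the time
  bound.\<close>

lemma runs_While:
  assumes N: "N \<le> L" and init: "I 0 s"
    and step: "\<And>i s. i < N \<Longrightarrow> I i s \<Longrightarrow> bval b s \<and> runs L c s (I (Suc i))"
    and final: "\<And>s. I N s \<Longrightarrow> \<not> bval b s \<and> Q s"
  shows "runs L (While b c) s Q"
proof -
  \<comment> \<open>Induction on the number \<open>n\<close> of remaining iterations; only
    afterwards is the exact count \<open>N\<close> relaxed to \<open>L\<close>.\<close>
  have "\<exists>t s'. exec (While b c) s t s' \<and> t \<le> bcost b + n * (bcost b + loop_bound L c) \<and> Q s'"
    if "I i s" "i + n = N" for n i s
    using that
  proof (induction n arbitrary: i s)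
    case 0
    then show ?case using final[of s] by (fastforce intro: exec.WhileFalse)
  next
    case (Suc n)
    then have "i < N" by simp
    with step Suc.prems obtain t1 s1 where
      1: "bval b s" "exec c s t1 s1" "t1 \<le> loop_bound L c" "I (Suc i) s1"
      unfolding runs_def by blast
    with Suc.IH[of "Suc i" s1] Suc.prems obtain t2 s2 where
      2: "exec (While b c) s1 t2 s2" "t2 \<le> bcost b + n * (bcost b + loop_bound L c)" "Q s2"
      by auto
    show ?case
      by (rule exI[of _ "bcost b + t1 + t2"], rule exI[of _ s2])
        (use 1 2 in \<open>auto intro: exec.WhileTrue\<close>)
  qed
  from this[OF init, of N] obtain t s' where
    "exec (While b c) s t s'" "t \<le> bcost b + N * (bcost b + loop_bound L c)" "Q s'"
    by auto
  moreover have "N * (bcost b + loop_bound L c) \<le> L * (bcost b + loop_bound L c)"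
    using N by (rule mult_le_mono1)
  ultimately show ?thesis
    unfolding runs_def loop_bound.simps by (meson add_left_mono le_trans)
qed

section \<open>Derived constructs: counted loops, multiplication, division with remainder\<close>

abbreviation Var :: "string \<Rightarrow> aexp" where
  "Var x \<equiv> Read x (Const 0)"

abbreviation Assign :: "string \<Rightarrow> aexp \<Rightarrow> com" where
  "Assign x a \<equiv> Write x (Const 0) a"

definition For :: "string \<Rightarrow> aexp \<Rightarrow> com \<Rightarrow> com" where
  "For x b c = Seq (Assign x (Const 0))
     (While (Less (Var x) b) (Seq c (Assign x (Plus (Var x) (Const 1)))))"

text \<open>The test re-evaluates \<open>b\<close> before every iteration, so the invariant has to
  pin its value to \<open>N\<close>. The obligation for the body speaks of the state after the
  counter has been incremented.\<close>

lemma runs_For: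
  assumes N: "N \<le> L" and init: "I 0 (s(x := (s x)(0 := 0)))"
    and counter: "\<And>i s. i \<le> N \<Longrightarrow> I i s \<Longrightarrow> s x 0 = i \<and> aval b s = N"
    and step: "\<And>i s. i < N \<Longrightarrow> I i s \<Longrightarrow>
      runs L c s (\<lambda>s'. I (Suc i) (s'(x := (s' x)(0 := Suc (s' x 0)))))"
    and final: "\<And>s. I N s \<Longrightarrow> Q s"
  shows "runs L (For x b c) s Q"
  unfolding For_def
proof (rule runs_Seq, rule runs_Write, rule runs_While[OF N])
  show "I 0 (s(x := (s x)(aval (Const 0) s := aval (Const 0) s)))"
    using init by simp
next
  fix i s assume "i < N" "I i s"
  then show "bval (Less (Var x) b) s \<and>
    runs L (Seq c (Assign x (Plus (Var x) (Const 1)))) s (I (Suc i))"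
    using counter[of i s] by (auto intro!: runs_Seq runs_Write runs_mono[OF step])
next
  fix s assume "I N s"
  then show "\<not> bval (Less (Var x) b) s \<and> Q s"
    using counter[of N s] final by auto
qed

text \<open>Repeated addition, as the machine cannot multiply. The loop count is the second factor
  alone, so the first factor and the product may exceed \<open>L\<close>.\<close>

definition Mul :: "string \<Rightarrow> aexp \<Rightarrow> aexp \<Rightarrow> com" where
  "Mul z a b = Seq (Assign z (Const 0)) (For ''c'' b (Assign z (Plus (Var z) a)))"

lemma runs_Mul:
  assumes L: "aval b s \<le> L" and z: "z \<noteq> ''c''"
    and a: "\<And>f g. aval a (s(z := f, ''c'' := g)) = aval a s"
    and b: "\<And>f g. aval b (s(z := f, ''c'' := g)) = aval b s"
    and Q: "Q (s(z := (s z)(0 := aval a s * aval b s), ''c'' := (s ''c'')(0 := aval b s)))"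
  shows "runs L (Mul z a b) s Q"
proof -
  let ?I = "\<lambda>i s'. s' = s(z := (s z)(0 := aval a s * i), ''c'' := (s ''c'')(0 := i))"
  show ?thesis
    unfolding Mul_def
  proof (rule runs_Seq, rule runs_Write, rule runs_For[OF L, where I = ?I])
    show "s' ''c'' 0 = i \<and> aval b s' = aval b s" if "?I i s'" for i s'
      using that b by auto
    show "runs L (Assign z (Plus (Var z) a)) s'
        (\<lambda>s'. ?I (Suc i) (s'(''c'' := (s' ''c'')(0 := Suc (s' ''c'' 0)))))"
      if "?I i s'" for i s'
      by (rule runs_Write) (use a z in \<open>simp add: that fun_upd_twist add.commute\<close>)
  qed (use z Q in auto)
qed

text \<open>Repeated subtraction, leaving the remainder in \<open>x\<close> and the quotient in
  \<open>q\<close>. Adding 1 turns the strict comparison of the machine into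
  \<open>b \<le> x\<close>.\<close>

definition DivMod :: "string \<Rightarrow> string \<Rightarrow> aexp \<Rightarrow> com" where
  "DivMod q x b = Seq (Assign q (Const 0))
     (While (Less b (Plus (Var x) (Const 1)))
       (Seq (Assign x (Minus (Var x) b)) (Assign q (Plus (Var q) (Const 1)))))"

lemma runs_DivMod:
  assumes L: "s x 0 \<le> L" and x: "x \<noteq> q" and pos: "0 < aval b s"
    and b: "\<And>f g. aval b (s(x := f, q := g)) = aval b s"
    and Q: "Q (s(x := (s x)(0 := s x 0 mod aval b s), q := (s q)(0 := s x 0 div aval b s)))"
  shows "runs L (DivMod q x b) s Q"
proof -
  let ?N = "s x 0 div aval b s"
  let ?I = "\<lambda>i s'. s' = s(x := (s x)(0 := s x 0 - i * aval b s), q := (s q)(0 := i))"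
  show ?thesis
    unfolding DivMod_def
  proof (rule runs_Seq, rule runs_Write, rule runs_While[where N = ?N and I = ?I])
    show "?N \<le> L"
      using L div_le_dividend le_trans by blast
    show "bval (Less b (Plus (Var x) (Const 1))) s' \<and>
      runs L (Seq (Assign x (Minus (Var x) b)) (Assign q (Plus (Var q) (Const 1)))) s' (?I (Suc i))"
      if "i < ?N" "?I i s'" for i s'
    proof
      have "Suc i * aval b s \<le> s x 0"
        using that(1) by (metis Suc_leI less_eq_div_iff_mult_less_eq pos)
      then show "bval (Less b (Plus (Var x) (Const 1))) s'"
        using b x by (auto simp: that(2))
      show "runs L (Seq (Assign x (Minus (Var x) b)) (Assign q (Plus (Var q) (Const 1)))) s' (?I (Suc i))"
        by (rule runs_Seq, rule runs_Write, rule runs_Write)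
          (use b x in \<open>simp add: that(2) fun_upd_twist add.commute\<close>)
    qed
    show "\<not> bval (Less b (Plus (Var x) (Const 1))) s' \<and> Q s'" if "?I ?N s'" for s'
    proof -
      have "s x 0 - ?N * aval b s = s x 0 mod aval b s"
        by (simp add: minus_div_mult_eq_mod)
      then show ?thesis
        using that b x Q pos by (simp add: Suc_leI not_less)
    qed
  qed (use x in \<open>simp add: fun_upd_twist\<close>)
qed

section \<open>Points, lines and hyperedges as numbers and lists\<close>

section \<open>The gadgets\<close>

text \<open>Base-\<open>r\<close> digits, least significant first. They recover a tuple from its
  index in the truth table, the digit \<open>a\<close> standing for the letter \<open>a + 1\<close>;
  the slopes of the lines are these digits.\<close>

definition digit :: "nat \<Rightarrow> nat \<Rightarrow> nat \<Rightarrow> nat" where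
  "digit r t i = t div r ^ i mod r"

text \<open>The mixed-radix number of the point with coordinates \<open>x\<close> and
  \<open>y\<close> in the plane of \<open>v\<close>, so that \<open>n\<close> planes fill exactly
  the numbers below \<open>r * r * n\<close>.\<close>

definition point :: "nat \<Rightarrow> nat \<Rightarrow> nat \<Rightarrow> nat \<Rightarrow> nat" where
  "point r v x y = r * r * v + r * x + y"

definition line :: "nat \<Rightarrow> nat \<Rightarrow> nat \<Rightarrow> nat \<Rightarrow> nat list" where
  "line r v a j = map (\<lambda>x. point r v x ((a * x + j) mod r)) [0..<r]"

text \<open>For a vertex \<open>v\<close> of the constraint \<open>e\<close> this serves as the number of \<open>e\<close> at \<open>v\<close>.\<close>

definition earlier :: "(nat \<Rightarrow> nat \<Rightarrow> nat) \<Rightarrow> nat \<Rightarrow> nat \<Rightarrow> nat \<Rightarrow> nat" where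
  "earlier vs k e v = card {e'. e' < e \<and> (\<exists>i<k. vs e' i = v)}"

definition consistent :: "(nat \<Rightarrow> nat \<Rightarrow> nat) \<Rightarrow> nat \<Rightarrow> nat \<Rightarrow> nat \<Rightarrow> nat \<Rightarrow> bool" where
  "consistent vs k r e t \<longleftrightarrow> (\<forall>i<k. \<forall>j<k. vs e i = vs e j \<longrightarrow> digit r t i = digit r t j)"

definition gadget :: "(nat \<Rightarrow> nat \<Rightarrow> nat) \<Rightarrow> nat \<Rightarrow> nat \<Rightarrow> nat \<Rightarrow> nat \<Rightarrow> nat list" where
  "gadget vs k r e t =
     concat (map (\<lambda>i. line r (vs e i) (digit r t i) (earlier vs k e (vs e i))) [0..<k])"

text \<open>The cut-off \<open>n\<close> is a parameter so that a loop invariant can speak of the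
  tuples treated so far; \<open>m\<close> does the same for hyperedges in
  \<open>gadgets\<close>.\<close>

definition edge_gadgets ::
  "(nat \<Rightarrow> nat \<Rightarrow> nat) \<Rightarrow> (nat \<Rightarrow> nat \<Rightarrow> nat) \<Rightarrow> nat \<Rightarrow> nat \<Rightarrow> nat \<Rightarrow> nat \<Rightarrow> nat list list" where
  "edge_gadgets vs tab k r e n =
     map (gadget vs k r e) (filter (\<lambda>t. tab e t = 1 \<and> consistent vs k r e t) [0..<n])"

definition gadgets ::
  "(nat \<Rightarrow> nat \<Rightarrow> nat) \<Rightarrow> (nat \<Rightarrow> nat \<Rightarrow> nat) \<Rightarrow> nat \<Rightarrow> nat \<Rightarrow> nat \<Rightarrow> nat list list" where
  "gadgets vs tab k r m = concat (map (\<lambda>e. edge_gadgets vs tab k r e (r ^ k)) [0..<m])"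

text \<open>A hyperedge raises the count of each of its vertices by one, however often the vertex
  occurs in it. The array \<open>deg\<close> follows this recurrence.\<close>

lemma earlier_Suc:
  "earlier vs k (Suc e) v = earlier vs k e v + (if \<exists>i<k. vs e i = v then 1 else 0)"
proof -
  have "{e'. e' < Suc e \<and> (\<exists>i<k. vs e' i = v)} =
    (if \<exists>i<k. vs e i = v then insert e {e'. e' < e \<and> (\<exists>i<k. vs e' i = v)}
     else {e'. e' < e \<and> (\<exists>i<k. vs e' i = v)})"
    by (auto simp: less_Suc_eq)
  then show ?thesis unfolding earlier_def by auto
qed

text \<open>A crude bound on the intercepts that keeps the reduction of \<open>a * x + j\<close>
  modulo \<open>r\<close> within the time limit.\<close>

lemma earlier_le: "earlier vs k e v \<le> e"
  by (induction e) (auto simp: earlier_Suc, simp add: earlier_def)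

abbreviation encode_edges :: "nat list list \<Rightarrow> nat list" where
  "encode_edges hs \<equiv> concat (map (\<lambda>h. length h # h) hs)"

lemma edge_gadgets_Suc:
  "edge_gadgets vs tab k r e (Suc t) = edge_gadgets vs tab k r e t @
     (if tab e t = 1 \<and> consistent vs k r e t then [gadget vs k r e t] else [])"
  by (simp add: edge_gadgets_def)

lemma length_line: "length (line r v a j) = r"
  by (simp add: line_def)

text \<open>The length is the same for all tuples, so the program can emit it as a prefix before
  computing any point. A repeated vertex merely repeats points in the list of a consistent
  tuple.\<close>

lemma length_gadget: "length (gadget vs k r e t) = k * r"
  by (simp add: gadget_def length_concat o_def length_line sum_list_triv)

section \<open>The program, from the digits of one tuple up to the whole reduction\<close>

section \<open>The program\<close>

abbreviation InArity :: aexp where "InArity \<equiv> Read ''in'' (Const 2)"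
abbreviation InVertex :: "string \<Rightarrow> aexp" where
  "InVertex x \<equiv> Read ''in'' (Plus (Var ''p'') (Var x))"

text \<open>\<open>DivMod\<close> leaves the digit in \<open>w\<close> and the quotient in
  \<open>u\<close>; the quotient is the next number to divide.\<close>

definition digits_com :: com where
  "digits_com = Seq (Assign ''w'' (Var ''t''))
     (For ''i'' InArity
       (Seq (DivMod ''u'' ''w'' (Var ''r''))
         (Seq (Write ''A'' (Var ''i'') (Var ''w''))
           (Assign ''w'' (Var ''u'')))))"

definition check_com :: com where
  "check_com = Seq (Assign ''ok'' (Const 1))
     (For ''i'' InArity
       (For ''j'' InArity
         (If (Equal (InVertex ''i'') (InVertex ''j''))
           (If (Equal (Read ''A'' (Var ''i'')) (Read ''A'' (Var ''j'')))
             Skip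
             (Assign ''ok'' (Const 0)))
           Skip)))"

definition emit_com :: "aexp \<Rightarrow> com" where
  "emit_com a = Seq (Write ''out'' (Var ''q'') a) (Assign ''q'' (Plus (Var ''q'') (Const 1)))"

definition line_com :: com where
  "line_com = Seq (Mul ''b'' (Var ''rr'') (InVertex ''i''))
     (For ''x'' (Var ''r'')
       (Seq (Mul ''y'' (Read ''A'' (Var ''i'')) (Var ''x''))
         (Seq (Assign ''y'' (Plus (Var ''y'') (Read ''J'' (Var ''i''))))
           (Seq (DivMod ''u'' ''y'' (Var ''r''))
             (Seq (Mul ''z'' (Var ''r'') (Var ''x''))
               (emit_com (Plus (Plus (Var ''b'') (Var ''z'')) (Var ''y''))))))))"

definition gadget_com :: com where
  "gadget_com = Seq (Assign ''cnt'' (Plus (Var ''cnt'') (Const 1)))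
     (Seq (emit_com (Var ''kr'')) (For ''i'' InArity line_com))"

definition tuple_com :: com where
  "tuple_com = If (Equal (Read ''in'' (Plus (Plus (Var ''p'') InArity) (Var ''t''))) (Const 1))
     (Seq digits_com (Seq check_com (If (Equal (Var ''ok'') (Const 1)) gadget_com Skip)))
     Skip"

text \<open>All old counts are saved in \<open>J\<close> before any entry of \<open>deg\<close>
  changes. Writing \<open>J + 1\<close> rather than incrementing \<open>deg\<close> counts the
  hyperedge only once at a vertex that it repeats, and \<open>J\<close> keeps the intercepts for all
  its tuples.\<close>

definition edge_com :: com where
  "edge_com = Seq (For ''i'' InArity (Write ''J'' (Var ''i'') (Read ''deg'' (InVertex ''i''))))
     (Seq (For ''i'' InArity
         (Write ''deg'' (InVertex ''i'') (Plus (Read ''J'' (Var ''i'')) (Const 1))))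
       (Seq (For ''t'' (Var ''T'') tuple_com)
         (Assign ''p'' (Plus (Var ''p'') (Plus InArity (Var ''T''))))))"

text \<open>Input cell 0 holds the length and cells 1 to 4 the header, hence \<open>p\<close> starts
  at 5. The powers of \<open>r\<close> pass through \<open>u\<close> because \<open>Mul\<close>
  clears its target first. For \<open>k = 0\<close> the value of \<open>T\<close> stays 1, the size
  of the truth table.\<close>

definition init_com :: com where
  "init_com = Seq (If (Less (Const 0) InArity)
       (Assign ''r'' (Read ''in'' (Const 1))) (Assign ''r'' (Const 0)))
     (Seq (Mul ''rr'' (Var ''r'') (Var ''r''))
     (Seq (Mul ''n'' (Var ''rr'') (Read ''in'' (Const 3)))
     (Seq (Mul ''kr'' (Var ''r'') InArity)
     (Seq (Assign ''p'' (Const 5))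
     (Seq (Assign ''q'' (Const 3))
     (Seq (Assign ''T'' (Const 1))
     (For ''i'' InArity (Seq (Mul ''u'' (Var ''T'') (Var ''r'')) (Assign ''T'' (Var ''u''))))))))))"

text \<open>\<open>q\<close> is the next free output cell. As cell 0 holds the length itself, the
  list ends in cell \<open>q - 1\<close> and has that length.\<close>

definition reduction_com :: com where
  "reduction_com = Seq init_com
     (Seq (For ''e'' (Read ''in'' (Const 4)) edge_com)
     (Seq (Write ''out'' (Const 1) (Var ''n''))
     (Seq (Write ''out'' (Const 2) (Var ''cnt''))
     (Write ''out'' (Const 0) (Minus (Var ''q'') (Const 1))))))"

section \<open>Frame conditions and the output buffer\<close>

definition unchanged :: "string set \<Rightarrow> state \<Rightarrow> state \<Rightarrow> bool" where
  "unchanged X s s' \<longleftrightarrow> (\<forall>x. x \<notin> X \<longrightarrow> s' x = s x)"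

lemma unchangedD: "unchanged X s s' \<Longrightarrow> x \<notin> X \<Longrightarrow> s' x = s x"
  by (simp add: unchanged_def)

lemma unchanged_refl: "unchanged X s s"
  by (simp add: unchanged_def)

lemma unchanged_upd: "unchanged X s s' \<Longrightarrow> x \<in> X \<Longrightarrow> unchanged X s (s'(x := f))"
  by (auto simp: unchanged_def)

lemma unchanged_trans: "unchanged X s s' \<Longrightarrow> unchanged Y s' s'' \<Longrightarrow> X \<union> Y \<subseteq> Z \<Longrightarrow> unchanged Z s s''"
  unfolding unchanged_def by (metis UnCI subsetD)

lemma unchanged_extend: "unchanged X s s' \<Longrightarrow> unchanged Y s' s'' \<Longrightarrow> Y \<subseteq> X \<Longrightarrow> unchanged X s s''"
  by (auto simp: unchanged_def)

text \<open>The cells 0 to 2 of the output hold its length, the number of vertices and the number of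
  hyperedges, which are written last.\<close>

definition emitted :: "nat list \<Rightarrow> state \<Rightarrow> bool" where
  "emitted xs s \<longleftrightarrow> s ''q'' 0 = 3 + length xs \<and> (\<forall>l<length xs. s ''out'' (3 + l) = xs ! l)"

lemma emitted_unchanged:
  "emitted xs s \<Longrightarrow> unchanged X s s' \<Longrightarrow> ''q'' \<notin> X \<Longrightarrow> ''out'' \<notin> X \<Longrightarrow> emitted xs s'"
  by (simp add: emitted_def unchangedD)

lemma runs_emit:
  assumes "emitted xs s"
    and "\<And>s'. emitted (xs @ [aval a s]) s' \<Longrightarrow> unchanged {''q'', ''out''} s s' \<Longrightarrow> Q s'"
  shows "runs L (emit_com a) s Q"
  unfolding emit_com_def
  by (intro runs_Seq runs_Write assms(2))
    (use assms(1) in \<open>auto simp: emitted_def unchanged_def nth_append less_Suc_eq\<close>)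

abbreviation line_vars :: "string set" where
  "line_vars \<equiv> {''q'', ''out'', ''b'', ''x'', ''y'', ''z'', ''u'', ''c''}"

abbreviation gadget_vars :: "string set" where
  "gadget_vars \<equiv> {''q'', ''out'', ''b'', ''x'', ''y'', ''z'', ''u'', ''c'', ''i'', ''cnt''}"

abbreviation tuple_vars :: "string set" where
  "tuple_vars \<equiv> {''q'', ''out'', ''b'', ''x'', ''y'', ''z'', ''u'', ''c'', ''i'', ''cnt'', ''j'', ''ok'', ''w'', ''A''}"

abbreviation edge_loop_vars :: "string set" where
  "edge_loop_vars \<equiv> {''q'', ''out'', ''b'', ''x'', ''y'', ''z'', ''u'', ''c'', ''i'', ''cnt'', ''j'', ''ok'', ''w'', ''A'', ''t'', ''J'', ''deg''}"

abbreviation edge_vars :: "string set" where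
  "edge_vars \<equiv> {''q'', ''out'', ''b'', ''x'', ''y'', ''z'', ''u'', ''c'', ''i'', ''cnt'', ''j'', ''ok'', ''w'', ''A'', ''t'', ''J'', ''deg'', ''p''}"

abbreviation init_vars :: "string set" where
  "init_vars \<equiv> {''r'', ''rr'', ''n'', ''kr'', ''p'', ''q'', ''T'', ''i'', ''u'', ''c''}"

text \<open>Assumptions about the raw input array only. \<open>L\<close> has to bound the lengths of
  the counted loops, the second factors of products (among them \<open>n\<close> and the vertex
  numbers) and the dividends; \<open>r * r + m\<close> is there for the dividend
  \<open>a * x + j\<close>.\<close>

locale reduction_input =
  fixes inp :: "nat \<Rightarrow> nat" and k r m n L :: nat
  assumes inp: "inp 2 = k" "inp 3 = n" "inp 4 = m" "0 < k \<Longrightarrow> inp 1 = r"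
    and r_pos: "0 < k \<Longrightarrow> 0 < r" and r_0: "k = 0 \<Longrightarrow> r = 0"
    and L: "k \<le> L" "r \<le> L" "n \<le> L" "m \<le> L" "r ^ k \<le> L" "r * r + m \<le> L"
    and vertex_le: "\<And>e i. e < m \<Longrightarrow> i < k \<Longrightarrow> inp (5 + e * (k + r ^ k) + i) \<le> L"
begin

text \<open>Every hyperedge occupies a block of \<open>k + r ^ k\<close> cells, its vertex numbers
  followed by its truth table; the blocks start at cell 5.\<close>

definition vs :: "nat \<Rightarrow> nat \<Rightarrow> nat" where
  "vs e i = inp (5 + e * (k + r ^ k) + i)"

definition tab :: "nat \<Rightarrow> nat \<Rightarrow> nat" where
  "tab e t = inp (5 + e * (k + r ^ k) + k + t)"

definition ready :: "state \<Rightarrow> bool" where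
  "ready s \<longleftrightarrow> s ''in'' = inp \<and> s ''r'' 0 = r \<and> s ''rr'' 0 = r * r \<and> s ''kr'' 0 = k * r \<and>
     s ''T'' 0 = r ^ k \<and> s ''n'' 0 = r * r * n"

lemma ready_unchanged:
  assumes "ready s" "unchanged X s s'" "X \<inter> {''in'', ''r'', ''rr'', ''kr'', ''T'', ''n''} = {}"
  shows "ready s'"
proof -
  have "s' x = s x" if "x \<in> {''in'', ''r'', ''rr'', ''kr'', ''T'', ''n''}" for x
    using assms(2,3) that by (intro unchangedD[of X]) auto
  then show ?thesis using assms(1) by (simp add: ready_def)
qed

section \<open>Verification of the program, from the inner fragments outwards\<close>

lemma runs_digits:
  assumes s: "ready s" and t: "s ''t'' 0 = t" "t < r ^ k"
    and Q: "\<And>s'. unchanged {''w'', ''i'', ''A'', ''u''} s s' \<Longrightarrow> (\<And>i. i < k \<Longrightarrow> s' ''A'' i = digit r t i) \<Longrightarrow> Q s'"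
  shows "runs L digits_com s Q"
proof -
  let ?I = "\<lambda>i s'. unchanged {''w'', ''i'', ''A'', ''u''} s s' \<and> s' ''i'' 0 = i \<and>
    s' ''w'' 0 = t div r ^ i \<and> (\<forall>l<i. s' ''A'' l = digit r t l)"
  show ?thesis
    unfolding digits_com_def
  proof (rule runs_Seq, rule runs_Write, rule runs_For[OF L(1), where I = ?I])
    show "s' ''i'' 0 = i \<and> aval InArity s' = k" if "?I i s'" for i s'
      using that s inp by (auto simp: ready_def unchangedD)
    show "runs L
        (Seq (DivMod ''u'' ''w'' (Var ''r''))
          (Seq (Write ''A'' (Var ''i'') (Var ''w'')) (Assign ''w'' (Var ''u'')))) s'
        (\<lambda>s'. ?I (Suc i) (s'(''i'' := (s' ''i'')(0 := Suc (s' ''i'' 0)))))"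
      if "i < k" and I: "?I i s'" for i s'
    proof (rule runs_Seq, rule runs_DivMod)
      \<comment> \<open>The body is entered only if \<open>0 < k\<close>, and then \<open>r\<close>
        is positive; there is never a division by \<open>r = 0\<close>.\<close>
      have r: "s' ''r'' 0 = r" "0 < r"
        using I s r_pos \<open>i < k\<close> by (auto simp: ready_def unchangedD)
      show "0 < aval (Var ''r'') s'" using r by simp
      show "s' ''w'' 0 \<le> L"
        using I t L(5) by (auto intro: order_trans[OF div_le_dividend])
      show "runs L (Seq (Write ''A'' (Var ''i'') (Var ''w'')) (Assign ''w'' (Var ''u'')))
       (s'(''w'' := (s' ''w'')(0 := s' ''w'' 0 mod aval (Var ''r'') s'),
           ''u'' := (s' ''u'')(0 := s' ''w'' 0 div aval (Var ''r'') s')))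
       (\<lambda>s'. ?I (Suc i) (s'(''i'' := (s' ''i'')(0 := Suc (s' ''i'' 0)))))"
        by (rule runs_Seq, rule runs_Write, rule runs_Write)
          (use I r in \<open>auto simp: less_Suc_eq digit_def div_mult2_eq power_Suc2 simp del: power_Suc intro!: unchanged_upd\<close>)
    qed simp_all
    show "Q s'" if "?I k s'" for s'
      using that by (intro Q) auto
  qed (use t in \<open>auto intro!: unchanged_upd unchanged_refl\<close>)
qed

lemma runs_check:
  assumes s: "ready s" and e: "s ''p'' 0 = 5 + e * (k + r ^ k)"
    and A: "\<And>i. i < k \<Longrightarrow> s ''A'' i = digit r t i"
    and Q: "\<And>s'. unchanged {''ok'', ''i'', ''j''} s s' \<Longrightarrow>
      s' ''ok'' 0 = (if consistent vs k r e t then 1 else 0) \<Longrightarrow> Q s'"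
  shows "runs L check_com s Q"
proof -
  let ?c = "\<lambda>i j. vs e i = vs e j \<longrightarrow> digit r t i = digit r t j"
  let ?I = "\<lambda>i s'. unchanged {''ok'', ''i'', ''j''} s s' \<and> s' ''i'' 0 = i \<and>
    s' ''ok'' 0 = (if \<forall>i'<i. \<forall>j<k. ?c i' j then 1 else 0)"
  let ?I' = "\<lambda>i j s'. unchanged {''ok'', ''i'', ''j''} s s' \<and> s' ''i'' 0 = i \<and> s' ''j'' 0 = j \<and>
    s' ''ok'' 0 = (if (\<forall>i'<i. \<forall>j<k. ?c i' j) \<and> (\<forall>j'<j. ?c i j') then 1 else 0)"
  show ?thesis
    unfolding check_com_def
  proof (rule runs_Seq, rule runs_Write, rule runs_For[OF L(1), where I = ?I])
    show "s' ''i'' 0 = i \<and> aval InArity s' = k" if "?I i s'" for i s'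
      using that s inp by (auto simp: ready_def unchangedD)
    show "runs L
         (For ''j'' InArity
           (If (Equal (InVertex ''i'') (InVertex ''j''))
             (If (Equal (Read ''A'' (Var ''i'')) (Read ''A'' (Var ''j''))) Skip (Assign ''ok'' (Const 0)))
             Skip)) s'
        (\<lambda>s'. ?I (Suc i) (s'(''i'' := (s' ''i'')(0 := Suc (s' ''i'' 0)))))"
      if "i < k" and I: "?I i s'" for i s'
    proof (rule runs_For[OF L(1), where I = "?I' i"])
      show "s' ''j'' 0 = j \<and> aval InArity s' = k" if "?I' i j s'" for j s'
        using that s inp by (auto simp: ready_def unchangedD)
      show "runs L
           (If (Equal (InVertex ''i'') (InVertex ''j''))
             (If (Equal (Read ''A'' (Var ''i'')) (Read ''A'' (Var ''j''))) Skip (Assign ''ok'' (Const 0)))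
             Skip) s'
        (\<lambda>s'. ?I' i (Suc j) (s'(''j'' := (s' ''j'')(0 := Suc (s' ''j'' 0)))))"
        if "j < k" and I: "?I' i j s'" for j s'
      proof -
        have *: "s' ''A'' i = digit r t i" "s' ''A'' j = digit r t j"
          "s' ''in'' (s' ''p'' 0 + i) = vs e i" "s' ''in'' (s' ''p'' 0 + j) = vs e j"
          using I s e A \<open>i < k\<close> \<open>j < k\<close> by (auto simp: ready_def unchangedD vs_def)
        show ?thesis
          by (intro runs_If runs_Skip runs_Write)
            (use I * in \<open>auto simp: less_Suc_eq intro!: unchanged_upd\<close>)
      qed
    qed (use I in \<open>auto simp: less_Suc_eq intro!: unchanged_upd\<close>)
    show "Q s'" if "?I k s'" for s'
      using that by (intro Q) (auto simp: consistent_def)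
  qed (auto intro!: unchanged_upd unchanged_refl)
qed

lemma runs_line:
  assumes s: "ready s" and e: "s ''p'' 0 = 5 + e * (k + r ^ k)" "e < m"
    and i: "s ''i'' 0 = i" "i < k"
    and A: "s ''A'' i = digit r t i" and J: "s ''J'' i = earlier vs k e (vs e i)"
    and xs: "emitted xs s"
    and Q: "\<And>s'. unchanged line_vars s s' \<Longrightarrow>
      emitted (xs @ line r (vs e i) (digit r t i) (earlier vs k e (vs e i))) s' \<Longrightarrow> Q s'"
  shows "runs L line_com s Q"
proof -
  let ?X = line_vars
  let ?f = "\<lambda>x. point r (vs e i) x ((digit r t i * x + earlier vs k e (vs e i)) mod r)"
  let ?I = "\<lambda>x s'. unchanged ?X s s' \<and> s' ''x'' 0 = x \<and> s' ''b'' 0 = r * r * vs e i \<and>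
    emitted (xs @ map ?f [0..<x]) s'"
  have v: "s ''in'' (s ''p'' 0 + i) = vs e i" "vs e i \<le> L"
    using s e i vertex_le by (auto simp: ready_def vs_def)
  have "0 < r" using i r_pos by simp
  show ?thesis
    unfolding line_com_def
  proof (rule runs_Seq, rule runs_Mul)
    show "aval (InVertex ''i'') s \<le> L" using v i by simp
    let ?s = "s(''b'' := (s ''b'')(0 := aval (Var ''rr'') s * aval (InVertex ''i'') s),
      ''c'' := (s ''c'')(0 := aval (InVertex ''i'') s))"
    show "runs L (For ''x'' (Var ''r'')
       (Seq (Mul ''y'' (Read ''A'' (Var ''i'')) (Var ''x''))
         (Seq (Assign ''y'' (Plus (Var ''y'') (Read ''J'' (Var ''i''))))
           (Seq (DivMod ''u'' ''y'' (Var ''r''))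
             (Seq (Mul ''z'' (Var ''r'') (Var ''x''))
               (emit_com (Plus (Plus (Var ''b'') (Var ''z'')) (Var ''y'')))))))) ?s Q"
    proof (rule runs_For[OF L(2), where I = ?I])
      show "s' ''x'' 0 = x \<and> aval (Var ''r'') s' = r" if "?I x s'" for x s'
        using that s by (auto simp: ready_def unchangedD)
      show "runs L
        (Seq (Mul ''y'' (Read ''A'' (Var ''i'')) (Var ''x''))
         (Seq (Assign ''y'' (Plus (Var ''y'') (Read ''J'' (Var ''i''))))
           (Seq (DivMod ''u'' ''y'' (Var ''r''))
             (Seq (Mul ''z'' (Var ''r'') (Var ''x''))
               (emit_com (Plus (Plus (Var ''b'') (Var ''z'')) (Var ''y''))))))) s'
        (\<lambda>s'. ?I (Suc x) (s'(''x'' := (s' ''x'')(0 := Suc (s' ''x'' 0)))))"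
        if "x < r" and I: "?I x s'" for x s'
      proof -
        have *: "s' ''r'' 0 = r" "s' ''A'' i = digit r t i" "s' ''J'' i = earlier vs k e (vs e i)"
          "s' ''i'' 0 = i" "s' ''x'' 0 = x" "s' ''b'' 0 = r * r * vs e i"
          using I s A J i by (auto simp: ready_def unchangedD)
        \<comment> \<open>The remainder modulo \<open>r\<close> is found by repeated subtraction, so
          the number to be reduced must itself be at most \<open>L\<close>.\<close>
        have "digit r t i < r" using \<open>0 < r\<close> by (simp add: digit_def)
        then have "digit r t i * x \<le> r * r"
          using \<open>x < r\<close> by (intro mult_le_mono) auto
        moreover have "earlier vs k e (vs e i) \<le> m"
          using earlier_le[of vs k e] e(2) by (meson le_trans less_imp_le)
        ultimately have y: "digit r t i * x + earlier vs k e (vs e i) \<le> L"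
          using L(6) by linarith
        show ?thesis
          apply (rule runs_Seq, rule runs_Mul)
              apply (use * \<open>x < r\<close> L in simp_all)[4]
          apply (rule runs_Seq, rule runs_Write, rule runs_Seq, rule runs_DivMod)
              apply (use * y \<open>0 < r\<close> in simp_all)[4]
          apply (rule runs_Seq, rule runs_Mul)
              apply (use * \<open>x < r\<close> L in simp_all)[4]
          apply (rule runs_emit[where xs = "xs @ map ?f [0..<x]"])
          subgoal using I by (simp add: emitted_def)
          subgoal premises that for s''
          proof (intro conjI)
            show "unchanged ?X s (s''(''x'' := (s'' ''x'')(0 := Suc (s'' ''x'' 0))))"
              by (rule unchanged_upd, rule unchanged_extend[OF _ that(2)], intro unchanged_upd)
                (use I in simp_all)
          qed (use that I * in \<open>simp_all add: point_def emitted_def unchangedD\<close>)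
          done
      qed
      show "Q s'" if "?I r s'" for s'
        using that by (intro Q) (auto simp: line_def)
    qed (use xs v s i in \<open>auto simp: ready_def emitted_def intro!: unchanged_upd unchanged_refl\<close>)
  qed simp_all
qed

lemma runs_gadget:
  assumes s: "ready s" and e: "s ''p'' 0 = 5 + e * (k + r ^ k)" "e < m"
    and A: "\<And>i. i < k \<Longrightarrow> s ''A'' i = digit r t i"
    and J: "\<And>i. i < k \<Longrightarrow> s ''J'' i = earlier vs k e (vs e i)"
    and xs: "emitted xs s"
    and Q: "\<And>s'. unchanged gadget_vars s s' \<Longrightarrow>
      s' ''cnt'' 0 = Suc (s ''cnt'' 0) \<Longrightarrow> emitted (xs @ (k * r) # gadget vs k r e t) s' \<Longrightarrow> Q s'"
  shows "runs L gadget_com s Q"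
proof -
  let ?X = gadget_vars
  let ?f = "\<lambda>i. line r (vs e i) (digit r t i) (earlier vs k e (vs e i))"
  let ?I = "\<lambda>i s'. unchanged ?X s s' \<and> s' ''i'' 0 = i \<and> s' ''cnt'' 0 = Suc (s ''cnt'' 0) \<and>
    emitted (xs @ (k * r) # concat (map ?f [0..<i])) s'"
  show ?thesis
    unfolding gadget_com_def
  proof (rule runs_Seq, rule runs_Write, rule runs_Seq, rule runs_emit[where xs = xs])
    fix s1
    assume s1: "emitted (xs @ [aval (Var ''kr'') (s(''cnt'' := (s ''cnt'')
        (aval (Const 0) s := aval (Plus (Var ''cnt'') (Const 1)) s)))]) s1"
      "unchanged {''q'', ''out''} (s(''cnt'' := (s ''cnt'')
        (aval (Const 0) s := aval (Plus (Var ''cnt'') (Const 1)) s))) s1"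
    show "runs L (For ''i'' InArity line_com) s1 Q"
    proof (rule runs_For[OF L(1), where I = ?I])
      show "s' ''i'' 0 = i \<and> aval InArity s' = k" if "?I i s'" for i s'
        using that s inp by (auto simp: ready_def unchangedD)
      show "?I 0 (s1(''i'' := (s1 ''i'')(0 := 0)))"
      proof (intro conjI)
        show "unchanged ?X s (s1(''i'' := (s1 ''i'')(0 := 0)))"
          by (rule unchanged_upd, rule unchanged_extend[OF _ s1(2)], rule unchanged_upd)
            (simp_all add: unchanged_refl)
      qed (use s1 s in \<open>simp_all add: ready_def emitted_def unchangedD\<close>)
      show "runs L line_com s' (\<lambda>s'. ?I (Suc i) (s'(''i'' := (s' ''i'')(0 := Suc (s' ''i'' 0)))))"
        if "i < k" and I: "?I i s'" for i s'
      proof (rule runs_line[where i = i and t = t and e = e])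
        show "ready s'" using s I by (auto intro: ready_unchanged)
        show "emitted (xs @ (k * r) # concat (map ?f [0..<i])) s'" using I by simp
        fix s'' assume *: "unchanged line_vars s' s''"
          "emitted ((xs @ (k * r) # concat (map ?f [0..<i])) @ ?f i) s''"
        show "?I (Suc i) (s''(''i'' := (s'' ''i'')(0 := Suc (s'' ''i'' 0))))"
        proof (intro conjI)
          show "unchanged ?X s (s''(''i'' := (s'' ''i'')(0 := Suc (s'' ''i'' 0))))"
            by (rule unchanged_upd, rule unchanged_extend[OF _ *(1)]) (use I in simp_all)
        qed (use * I in \<open>simp_all add: emitted_def unchangedD\<close>)
      qed (use that e A J in \<open>auto simp: unchangedD\<close>)
      show "Q s'" if "?I k s'" for s'
        using that by (intro Q) (auto simp: gadget_def)
    qed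
  qed (use xs in \<open>simp add: emitted_def\<close>)
qed

lemma runs_tuple:
  assumes s: "ready s" and e: "s ''p'' 0 = 5 + e * (k + r ^ k)" "e < m"
    and t: "s ''t'' 0 = t" "t < r ^ k"
    and J: "\<And>i. i < k \<Longrightarrow> s ''J'' i = earlier vs k e (vs e i)"
    and xs: "emitted xs s"
    and Q: "\<And>s'. unchanged tuple_vars s s' \<Longrightarrow>
      s' ''cnt'' 0 = s ''cnt'' 0 + (if tab e t = 1 \<and> consistent vs k r e t then 1 else 0) \<Longrightarrow>
      emitted (xs @ (if tab e t = 1 \<and> consistent vs k r e t then (k * r) # gadget vs k r e t else [])) s' \<Longrightarrow> Q s'"
  shows "runs L tuple_com s Q"
proof -
  have tab: "aval (Read ''in'' (Plus (Plus (Var ''p'') InArity) (Var ''t''))) s = tab e t"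
    using s e t inp by (simp add: ready_def tab_def)
  have "runs L (Seq digits_com (Seq check_com (If (Equal (Var ''ok'') (Const 1)) gadget_com Skip))) s Q"
    if 1: "tab e t = 1"
  proof (rule runs_Seq, rule runs_digits[OF s t], rule runs_Seq, rule runs_check)
    fix s1 assume s1: "unchanged {''w'', ''i'', ''A'', ''u''} s s1"
      "\<And>i. i < k \<Longrightarrow> s1 ''A'' i = digit r t i"
    show ready1: "ready s1" using s s1(1) by (rule ready_unchanged) simp
    show "s1 ''p'' 0 = 5 + e * (k + r ^ k)" using e s1(1) by (simp add: unchangedD)
    show "s1 ''A'' i = digit r t i" if "i < k" for i using s1(2) that .
    fix s2 assume s2: "unchanged {''ok'', ''i'', ''j''} s1 s2"
      "s2 ''ok'' 0 = (if consistent vs k r e t then 1 else 0)"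
    have ready2: "ready s2" using ready1 s2(1) by (rule ready_unchanged) simp
    have un: "unchanged {''w'', ''i'', ''A'', ''u'', ''ok'', ''j''} s s2"
      using s1(1) s2(1) by (rule unchanged_trans) simp
    show "runs L (If (Equal (Var ''ok'') (Const 1)) gadget_com Skip) s2 Q"
    proof (rule runs_If)
      assume "bval (Equal (Var ''ok'') (Const 1)) s2"
      then have c: "consistent vs k r e t" using s2(2) by (cases "consistent vs k r e t") simp_all
      show "runs L gadget_com s2 Q"
      proof (rule runs_gadget[OF ready2, where e = e and t = t and xs = xs])
        show "s2 ''p'' 0 = 5 + e * (k + r ^ k)" using e un by (simp add: unchangedD)
        show "s2 ''A'' i = digit r t i" if "i < k" for i
          using s1(2) s2(1) that by (simp add: unchangedD)
        show "s2 ''J'' i = earlier vs k e (vs e i)" if "i < k" for i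
          using J un that by (simp add: unchangedD)
        show "emitted xs s2" using xs un by (rule emitted_unchanged) simp_all
        show "Q s'" if "unchanged gadget_vars s2 s'"
          "s' ''cnt'' 0 = Suc (s2 ''cnt'' 0)" "emitted (xs @ (k * r) # gadget vs k r e t) s'" for s'
        proof (rule Q)
          show "unchanged tuple_vars s s'"
            using un that(1) by (rule unchanged_trans) simp
        qed (use that un c 1 in \<open>simp_all add: unchangedD\<close>)
      qed (use e in simp)
    next
      assume "\<not> bval (Equal (Var ''ok'') (Const 1)) s2"
      then have c: "\<not> consistent vs k r e t" using s2(2) by (cases "consistent vs k r e t") simp_all
      show "runs L Skip s2 Q"
      proof (rule runs_Skip, rule Q)
        show "unchanged tuple_vars s s2"
          using un unchanged_refl[of "{}"] by (rule unchanged_trans) simp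
        have "emitted xs s2" using xs un by (rule emitted_unchanged) simp_all
        then show "emitted (xs @ (if tab e t = 1 \<and> consistent vs k r e t then (k * r) # gadget vs k r e t else [])) s2"
          using c by simp
      qed (use un c in \<open>simp add: unchangedD\<close>)
    qed
  qed
  then show ?thesis
    unfolding tuple_com_def using tab xs
    by (intro runs_If runs_Skip Q) (simp_all add: unchanged_refl)
qed

lemma runs_edge:
  assumes s: "ready s" and e: "s ''p'' 0 = 5 + e * (k + r ^ k)" "e < m"
    and deg: "s ''deg'' = earlier vs k e"
    and xs: "emitted xs s"
    and Q: "\<And>s'. unchanged edge_vars s s' \<Longrightarrow>
      s' ''p'' 0 = 5 + Suc e * (k + r ^ k) \<Longrightarrow> s' ''deg'' = earlier vs k (Suc e) \<Longrightarrow>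
      s' ''cnt'' 0 = s ''cnt'' 0 + length (edge_gadgets vs tab k r e (r ^ k)) \<Longrightarrow>
      emitted (xs @ encode_edges (edge_gadgets vs tab k r e (r ^ k))) s' \<Longrightarrow> Q s'"
  shows "runs L edge_com s Q"
proof -
  let ?I = "\<lambda>i s'. unchanged {''i'', ''J''} s s' \<and> s' ''i'' 0 = i \<and>
    (\<forall>l<i. s' ''J'' l = earlier vs k e (vs e l))"
  \<comment> \<open>After \<open>i\<close> positions, \<open>deg\<close> exceeds the old count by
    one exactly at the vertices met so far; meeting a vertex again writes the same value.\<close>
  let ?D = "\<lambda>i s'. unchanged {''i'', ''J'', ''deg''} s s' \<and> s' ''i'' 0 = i \<and>
    (\<forall>l<k. s' ''J'' l = earlier vs k e (vs e l)) \<and>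
    s' ''deg'' = (\<lambda>v. earlier vs k e v + (if \<exists>l<i. vs e l = v then 1 else 0))"
  let ?X = edge_loop_vars
  let ?T = "\<lambda>t s'. unchanged ?X s s' \<and> s' ''t'' 0 = t \<and>
    (\<forall>l<k. s' ''J'' l = earlier vs k e (vs e l)) \<and> s' ''deg'' = earlier vs k (Suc e) \<and>
    s' ''cnt'' 0 = s ''cnt'' 0 + length (edge_gadgets vs tab k r e t) \<and>
    emitted (xs @ encode_edges (edge_gadgets vs tab k r e t)) s'"
  have v: "s' ''in'' (s' ''p'' 0 + i) = vs e i" if "unchanged X s s'" "''in'' \<notin> X" "''p'' \<notin> X" for X s' i
    using that s e by (simp add: unchangedD ready_def vs_def)
  show ?thesis
    unfolding edge_com_def
  proof (rule runs_Seq, rule runs_For[OF L(1), where I = ?I])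
    show "s' ''i'' 0 = i \<and> aval InArity s' = k" if "?I i s'" for i s'
      using that s inp by (auto simp: ready_def unchangedD)
    show "runs L (Write ''J'' (Var ''i'') (Read ''deg'' (InVertex ''i''))) s'
        (\<lambda>s'. ?I (Suc i) (s'(''i'' := (s' ''i'')(0 := Suc (s' ''i'' 0)))))"
      if "i < k" and I: "?I i s'" for i s'
    proof (rule runs_Write)
      have "s' ''deg'' = earlier vs k e" using I deg by (auto simp: unchangedD)
      moreover have "s' ''in'' (s' ''p'' 0 + i) = vs e i" using I by (intro v[of "{''i'', ''J''}"]) auto
      ultimately show "?I (Suc i) ((\<lambda>s'. s'(''i'' := (s' ''i'')(0 := Suc (s' ''i'' 0))))
        (s'(''J'' := (s' ''J'')(aval (Var ''i'') s' := aval (Read ''deg'' (InVertex ''i'')) s'))))"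
        using I by (auto simp: less_Suc_eq intro!: unchanged_upd)
    qed
    fix s1 assume s1: "?I k s1"
    show "runs L (Seq (For ''i'' InArity
         (Write ''deg'' (InVertex ''i'') (Plus (Read ''J'' (Var ''i'')) (Const 1))))
       (Seq (For ''t'' (Var ''T'') tuple_com)
         (Assign ''p'' (Plus (Var ''p'') (Plus InArity (Var ''T'')))))) s1 Q"
    proof (rule runs_Seq, rule runs_For[OF L(1), where I = ?D])
      show "?D 0 (s1(''i'' := (s1 ''i'')(0 := 0)))"
      proof (intro conjI)
        show "unchanged {''i'', ''J'', ''deg''} s (s1(''i'' := (s1 ''i'')(0 := 0)))"
          using s1 by (auto simp: unchanged_def)
      qed (use s1 deg in \<open>auto simp: unchangedD\<close>)
      show "s' ''i'' 0 = i \<and> aval InArity s' = k" if "?D i s'" for i s'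
        using that s inp by (auto simp: ready_def unchangedD)
      show "runs L (Write ''deg'' (InVertex ''i'') (Plus (Read ''J'' (Var ''i'')) (Const 1))) s'
          (\<lambda>s'. ?D (Suc i) (s'(''i'' := (s' ''i'')(0 := Suc (s' ''i'' 0)))))"
        if "i < k" and I: "?D i s'" for i s'
      proof (rule runs_Write)
        have "s' ''in'' (s' ''p'' 0 + i) = vs e i"
          using I by (intro v[of "{''i'', ''J'', ''deg''}"]) auto
        then show "?D (Suc i) ((\<lambda>s'. s'(''i'' := (s' ''i'')(0 := Suc (s' ''i'' 0))))
          (s'(''deg'' := (s' ''deg'')(aval (InVertex ''i'') s' :=
             aval (Plus (Read ''J'' (Var ''i'')) (Const 1)) s'))))"
          using I \<open>i < k\<close> by (auto simp: less_Suc_eq fun_eq_iff intro!: unchanged_upd)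
      qed
      fix s2 assume s2: "?D k s2"
      show "runs L (Seq (For ''t'' (Var ''T'') tuple_com)
         (Assign ''p'' (Plus (Var ''p'') (Plus InArity (Var ''T''))))) s2 Q"
      proof (rule runs_Seq, rule runs_For[OF L(5), where I = ?T])
        have "unchanged {''i'', ''J'', ''deg''} s s2" using s2 by blast
        then show "?T 0 (s2(''t'' := (s2 ''t'')(0 := 0)))"
        proof (intro conjI)
          show "unchanged ?X s (s2(''t'' := (s2 ''t'')(0 := 0)))"
            by (rule unchanged_upd, rule unchanged_extend[OF unchanged_refl, of "{''i'', ''J'', ''deg''}"])
              (use s2 in auto)
        qed (use s2 xs in \<open>auto simp: unchangedD earlier_Suc fun_eq_iff edge_gadgets_def emitted_def\<close>)
        show "s' ''t'' 0 = t \<and> aval (Var ''T'') s' = r ^ k" if "?T t s'" for t s'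
          using that s by (auto simp: ready_def unchangedD)
        show "runs L tuple_com s' (\<lambda>s'. ?T (Suc t) (s'(''t'' := (s' ''t'')(0 := Suc (s' ''t'' 0)))))"
          if "t < r ^ k" and I: "?T t s'" for t s'
        proof (rule runs_tuple[where t = t and e = e])
          show "ready s'" using s conjunct1[OF I] by (rule ready_unchanged) simp
          show "emitted (xs @ encode_edges (edge_gadgets vs tab k r e t)) s'" using I by blast
          fix s'' assume *:
            "unchanged tuple_vars s' s''"
            "s'' ''cnt'' 0 = s' ''cnt'' 0 + (if tab e t = 1 \<and> consistent vs k r e t then 1 else 0)"
            "emitted ((xs @ encode_edges (edge_gadgets vs tab k r e t)) @
               (if tab e t = 1 \<and> consistent vs k r e t then (k * r) # gadget vs k r e t else [])) s''"
          show "?T (Suc t) (s''(''t'' := (s'' ''t'')(0 := Suc (s'' ''t'' 0))))"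
          proof (intro conjI)
            show "unchanged ?X s (s''(''t'' := (s'' ''t'')(0 := Suc (s'' ''t'' 0))))"
              by (rule unchanged_upd, rule unchanged_extend[OF conjunct1[OF I] *(1)]) auto
            show "emitted (xs @ encode_edges (edge_gadgets vs tab k r e (Suc t)))
                (s''(''t'' := (s'' ''t'')(0 := Suc (s'' ''t'' 0))))"
              using *(3) by (auto simp: emitted_def edge_gadgets_Suc length_gadget)
          qed (use * I in \<open>auto simp: unchangedD edge_gadgets_Suc\<close>)
        qed (use that e in \<open>auto simp: unchangedD\<close>)
        fix s3 assume s3: "?T (r ^ k) s3"
        show "runs L (Assign ''p'' (Plus (Var ''p'') (Plus InArity (Var ''T'')))) s3 Q"
        proof (rule runs_Write, rule Q)
          show "unchanged edge_vars s
              (s3(''p'' := (s3 ''p'')(aval (Const 0) s3 := aval (Plus (Var ''p'') (Plus InArity (Var ''T''))) s3)))"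
            by (rule unchanged_upd, rule unchanged_trans[OF conjunct1[OF s3] unchanged_refl[of "{}"]]) auto
        qed (use s3 s e inp in \<open>auto simp: unchangedD ready_def emitted_def\<close>)
      qed
    qed
  qed (auto intro!: unchanged_upd unchanged_refl)
qed

lemma runs_init:
  assumes s: "s ''in'' = inp"
    and Q: "\<And>s'. unchanged init_vars s s' \<Longrightarrow>
      ready s' \<Longrightarrow> s' ''p'' 0 = 5 \<Longrightarrow> s' ''q'' 0 = 3 \<Longrightarrow> Q s'"
  shows "runs L init_com s Q"
proof -
  let ?X = init_vars
  let ?I = "\<lambda>i s'. unchanged ?X s s' \<and> s' ''i'' 0 = i \<and> s' ''T'' 0 = r ^ i \<and> s' ''r'' 0 = r \<and>
    s' ''rr'' 0 = r * r \<and> s' ''kr'' 0 = k * r \<and> s' ''n'' 0 = r * r * n \<and> s' ''p'' 0 = 5 \<and> s' ''q'' 0 = 3"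
  have "runs L (If (Less (Const 0) InArity)
       (Assign ''r'' (Read ''in'' (Const 1))) (Assign ''r'' (Const 0))) s
       (\<lambda>s'. s' = s(''r'' := (s ''r'')(0 := r)))"
    by (intro runs_If runs_Write) (use s inp r_0 in auto)
  then show ?thesis
    unfolding init_com_def
    apply (rule runs_Seq[OF runs_mono])
    apply hypsubst
    \<comment> \<open>The three products \<open>rr\<close>, \<open>n\<close> and \<open>kr\<close>,
      whose second factors are the values of \<open>r\<close>, the number of vertices and
      \<open>k\<close>.\<close>
    apply (rule runs_Seq, rule runs_Mul, use L in \<open>simp_all add: s inp\<close>)+
    apply (rule runs_Seq, rule runs_Write, simp)+
    apply (rule runs_For[OF L(1), where I = ?I])
    subgoal
      using s inp by (simp add: unchanged_upd unchanged_refl mult.commute)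
    subgoal
      using s inp by (auto simp: unchangedD)
    subgoal for i s'
      apply (rule runs_Seq, rule runs_Mul)
          apply (use L in simp_all)[4]
      apply (rule runs_Write)
      apply (simp add: unchanged_upd)
      done
    subgoal
      using s by (intro Q) (auto simp: ready_def unchangedD)
    done
qed

lemma runs_reduction:
  assumes s: "s = (\<lambda>_ _. 0)(''in'' := inp)"
  shows "runs L reduction_com s
    (\<lambda>s'. stores (s' ''out'') (encode_hypergraph (r * r * n) (gadgets vs tab k r m)))"
proof -
  let ?g = "\<lambda>e. gadgets vs tab k r e"
  let ?I = "\<lambda>e s'. ready s' \<and> s' ''e'' 0 = e \<and> s' ''p'' 0 = 5 + e * (k + r ^ k) \<and>
    s' ''deg'' = earlier vs k e \<and> s' ''cnt'' 0 = length (?g e) \<and> emitted (encode_edges (?g e)) s'"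
  show ?thesis
    unfolding reduction_com_def
  proof (rule runs_Seq, rule runs_init)
    show "s ''in'' = inp" using s by simp
    fix s1 assume s1: "unchanged init_vars s s1"
      "ready s1" "s1 ''p'' 0 = 5" "s1 ''q'' 0 = 3"
    show "runs L (Seq (For ''e'' (Read ''in'' (Const 4)) edge_com)
     (Seq (Write ''out'' (Const 1) (Var ''n''))
     (Seq (Write ''out'' (Const 2) (Var ''cnt''))
     (Write ''out'' (Const 0) (Minus (Var ''q'') (Const 1)))))) s1
       (\<lambda>s'. stores (s' ''out'') (encode_hypergraph (r * r * n) (?g m)))"
    proof (rule runs_Seq, rule runs_For[OF L(4), where I = ?I])
      \<comment> \<open>Memory outside the input is zero at the start, which serves as the initial
        value of both counters.\<close>
      have "s1 ''deg'' = (\<lambda>_. 0)" "s1 ''cnt'' = (\<lambda>_. 0)" using s1(1) s by (auto simp: unchangedD)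
      then show "?I 0 (s1(''e'' := (s1 ''e'')(0 := 0)))"
        using s1 by (simp add: ready_def gadgets_def emitted_def earlier_def fun_eq_iff)
      show "s' ''e'' 0 = e \<and> aval (Read ''in'' (Const 4)) s' = m" if "?I e s'" for e s'
        using that inp by (auto simp: ready_def)
      show "runs L edge_com s' (\<lambda>s'. ?I (Suc e) (s'(''e'' := (s' ''e'')(0 := Suc (s' ''e'' 0)))))"
        if "e < m" and I: "?I e s'" for e s'
      proof (rule runs_edge[where e = e and xs = "encode_edges (?g e)"])
        fix s'' assume *: "unchanged edge_vars s' s''"
          "s'' ''p'' 0 = 5 + Suc e * (k + r ^ k)" "s'' ''deg'' = earlier vs k (Suc e)"
          "s'' ''cnt'' 0 = s' ''cnt'' 0 + length (edge_gadgets vs tab k r e (r ^ k))"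
          "emitted (encode_edges (?g e) @ encode_edges (edge_gadgets vs tab k r e (r ^ k))) s''"
        show "?I (Suc e) (s''(''e'' := (s'' ''e'')(0 := Suc (s'' ''e'' 0))))"
        proof (intro conjI)
          have "ready s''" using conjunct1[OF I] *(1) by (rule ready_unchanged) simp
          then show "ready (s''(''e'' := (s'' ''e'')(0 := Suc (s'' ''e'' 0))))"
            by (simp add: ready_def)
        qed (use * I in \<open>auto simp: unchangedD gadgets_def emitted_def\<close>)
      qed (use that in auto)
      fix s2 assume s2: "?I m s2"
      then have out: "s2 ''q'' 0 = 3 + length (encode_edges (?g m))"
        "\<And>l. l < length (encode_edges (?g m)) \<Longrightarrow> s2 ''out'' (3 + l) = encode_edges (?g m) ! l"
        by (auto simp: emitted_def)
      show "runs L (Seq (Write ''out'' (Const 1) (Var ''n''))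
        (Seq (Write ''out'' (Const 2) (Var ''cnt''))
        (Write ''out'' (Const 0) (Minus (Var ''q'') (Const 1))))) s2
         (\<lambda>s'. stores (s' ''out'') (encode_hypergraph (r * r * n) (?g m)))"
      proof -
        let ?ys = "encode_edges (?g m)"
        define out where "out = (s2 ''out'')(1 := r * r * n, 2 := length (?g m), 0 := 2 + length ?ys)"
        have "stores out (r * r * n # length (?g m) # ?ys)"
          unfolding stores_def
        proof (intro conjI allI impI)
          fix i assume i: "i < length (r * r * n # length (?g m) # ?ys)"
          consider "i = 0" | "i = 1" | l where "i = Suc (Suc l)" by (metis One_nat_def nat.exhaust)
          then show "out (Suc i) = (r * r * n # length (?g m) # ?ys) ! i"
          proof cases
            case 3
            then show ?thesis using i out(2)[of l] by (simp add: out_def numeral_eq_Suc)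
          qed (simp_all add: out_def)
        qed (simp add: out_def)
        then show ?thesis
          using s2 out(1)
          by (intro runs_Seq runs_Write) (simp add: out_def ready_def encode_hypergraph_def)
      qed
    qed
  qed
qed

end

section \<open>Meeting and disjoint lines in the planes over the prime field\<close>

section \<open>Correctness of the reduction\<close>

lemma point_eq_iff:
  assumes "x < r" "y < r" "x' < r" "y' < r"
  shows "point r v x y = point r v' x' y' \<longleftrightarrow> v = v' \<and> x = x' \<and> y = y'"
proof
  assume eq: "point r v x y = point r v' x' y'"
  \<comment> \<open>In Horner form, division by \<open>r\<close> with remainder splits off first
    \<open>y\<close> and then \<open>x\<close>.\<close>
  have split: "point r v x y = r * (r * v + x) + y" for v x y
    by (simp add: point_def algebra_simps)
  have "y = y'" "r * v + x = r * v' + x'"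
    using eq assms(2,4) unfolding split
    by (metis mod_mult_self4 mod_less, metis div_mult_self4 div_less add.right_neutral less_nat_zero_code)
  moreover from this(2) have "x = x'" "v = v'"
    using assms(1,3)
    by (metis mod_mult_self4 mod_less, metis div_mult_self4 div_less add.right_neutral less_nat_zero_code)
  ultimately show "v = v' \<and> x = x' \<and> y = y'" by simp
qed simp

lemma point_less:
  assumes "v < n" "x < r" "y < r"
  shows "point r v x y < r * r * n"
proof -
  have "r * x + y < r * (x + 1)" using assms(3) by simp
  also have "\<dots> \<le> r * r" using assms(2) by (intro mult_le_mono2) simp
  finally have "point r v x y < r * r * (v + 1)" by (simp add: point_def algebra_simps)
  also have "\<dots> \<le> r * r * n" using assms(1) by (intro mult_le_mono2) simp
  finally show ?thesis .
qed

text \<open>The difference of the slopes is invertible modulo the prime \<open>r\<close>, so the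
  linear equation \<open>(a - a') x = j' - j\<close> is solvable. The computation takes place in the
  integers because both differences may be negative.\<close>

lemma lines_meet:
  fixes r a a' j j' :: nat
  assumes "prime r" "a < r" "a' < r" "a \<noteq> a'"
  shows "\<exists>x<r. (a * x + j) mod r = (a' * x + j') mod r"
proof -
  let ?d = "int a - int a'"
  have "\<not> int r dvd ?d"
  proof
    assume "int r dvd ?d"
    \<comment> \<open>A nonzero multiple of \<open>r\<close> has absolute value at least
      \<open>r\<close>, whereas both slopes lie between 0 and \<open>r - 1\<close>.\<close>
    then have "int r \<le> \<bar>?d\<bar>" using assms(4) by (intro zdvd_imp_le) auto
    then show False using assms(2,3) by linarith
  qed
  then have "coprime ?d (int r)"
    using assms(1) by (metis coprime_commute prime_imp_coprime prime_int_nat_transfer nat_int of_nat_0_le_iff)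
  then obtain x0 where x0: "[?d * x0 = 1] (mod int r)"
    using cong_solve_coprime_int by blast
  \<comment> \<open>The inverse \<open>x0\<close> of the slope difference times the intercept
    difference, reduced to a residue below \<open>r\<close>.\<close>
  define x where "x = nat ((x0 * (int j' - int j)) mod int r)"
  have "0 < r" using assms(1) prime_gt_0_nat by blast
  then have int_x: "int x = (x0 * (int j' - int j)) mod int r" by (simp add: x_def)
  then have "[?d * int x = ?d * (x0 * (int j' - int j))] (mod int r)"
    by (simp add: cong_def mod_mult_right_eq)
  also have "[?d * (x0 * (int j' - int j)) = 1 * (int j' - int j)] (mod int r)"
    using cong_scalar_right[OF x0, of "int j' - int j"] by (simp add: mult.assoc)
  \<comment> \<open>Adding \<open>a' * x + j\<close> on both sides cancels the negative terms and
    leaves a congruence of natural numbers.\<close>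
  finally have "[?d * int x + (int a' * int x + int j) =
      1 * (int j' - int j) + (int a' * int x + int j)] (mod int r)"
    by (intro cong_add) auto
  then have "[int (a * x + j) = int (a' * x + j')] (mod int r)"
    by (simp add: algebra_simps)
  then have "[a * x + j = a' * x + j'] (mod r)" using cong_int_iff by blast
  moreover have "x < r" using \<open>0 < r\<close> int_x by (metis of_nat_0_less_iff of_nat_less_iff pos_mod_bound)
  ultimately show ?thesis by (auto simp: cong_def)
qed

lemma set_gadget:
  "set (gadget vs k r e t) =
     {point r (vs e i) x ((digit r t i * x + earlier vs k e (vs e i)) mod r) | i x. i < k \<and> x < r}"
proof -
  have "set (gadget vs k r e t) =
     (\<Union>i<k. (\<lambda>x. point r (vs e i) x ((digit r t i * x + earlier vs k e (vs e i)) mod r)) ` {..<r})"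
    by (simp add: gadget_def line_def atLeast0LessThan)
  then show ?thesis by auto
qed

text \<open>In the plane of the shared vertex the two lines have different slopes and therefore a
  common point. The case \<open>e = e'\<close> is included: it makes tuples of one constraint that
  differ at some position conflict.\<close>

lemma gadgets_meet:
  assumes "prime r" "i < k" "i' < k" "vs e i = vs e' i'" "digit r t i \<noteq> digit r t' i'"
  shows "\<not> disjnt (set (gadget vs k r e t)) (set (gadget vs k r e' t'))"
proof -
  have "0 < r" using assms(1) prime_gt_0_nat by blast
  then obtain x where x: "x < r" "(digit r t i * x + earlier vs k e (vs e i)) mod r =
      (digit r t' i' * x + earlier vs k e' (vs e' i')) mod r"
    using lines_meet[OF assms(1) _ _ assms(5)] by (auto simp: digit_def)
  let ?p = "\<lambda>e t i. point r (vs e i) x ((digit r t i * x + earlier vs k e (vs e i)) mod r)"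
  have "?p e t i \<in> set (gadget vs k r e t)" "?p e' t' i' \<in> set (gadget vs k r e' t')"
    using assms(2,3) x(1) unfolding set_gadget by blast+
  moreover have "?p e t i = ?p e' t' i'" using x(2) assms(4) by simp
  ultimately show ?thesis by (auto simp: disjnt_iff)
qed

text \<open>The hyperedge \<open>e\<close> itself is counted for \<open>e'\<close> but not for
  \<open>e\<close>. Hence hyperedges sharing a vertex have different intercepts there.\<close>

lemma earlier_strict_mono:
  assumes "e < e'" "i < k" "vs e i = v"
  shows "earlier vs k e v < earlier vs k e' v"
  unfolding earlier_def
proof (rule psubset_card_mono)
  show "{e'. e' < e \<and> (\<exists>i<k. vs e' i = v)} \<subset> {e. e < e' \<and> (\<exists>i<k. vs e i = v)}"
    using assms by (intro psubsetI) auto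
qed simp

text \<open>A common point lies in the plane of a common vertex, where the slopes are equal; then
  the intercepts agree modulo \<open>r\<close>, which is impossible for different numbers below
  \<open>r\<close>.\<close>

lemma gadgets_disjoint:
  assumes "e \<noteq> e'"
    and digits: "\<And>i i'. i < k \<Longrightarrow> i' < k \<Longrightarrow> vs e i = vs e' i' \<Longrightarrow> digit r t i = digit r t' i'"
    and bound: "\<And>i. i < k \<Longrightarrow> earlier vs k e (vs e i) < r" "\<And>i. i < k \<Longrightarrow> earlier vs k e' (vs e' i) < r"
  shows "disjnt (set (gadget vs k r e t)) (set (gadget vs k r e' t'))"
proof (rule ccontr)
  assume "\<not> ?thesis"
  then obtain i x i' x' where ix: "i < k" "x < r" "i' < k" "x' < r"
    "point r (vs e i) x ((digit r t i * x + earlier vs k e (vs e i)) mod r) =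
     point r (vs e' i') x' ((digit r t' i' * x' + earlier vs k e' (vs e' i')) mod r)"
    unfolding disjnt_iff set_gadget by blast
  then have eq: "vs e i = vs e' i'" "x = x'"
    "(digit r t i * x + earlier vs k e (vs e i)) mod r =
     (digit r t' i' * x' + earlier vs k e' (vs e' i')) mod r"
    by (auto simp: point_eq_iff)
  then have "[digit r t i * x + earlier vs k e (vs e i) = digit r t i * x + earlier vs k e' (vs e i)] (mod r)"
    using digits ix by (simp add: cong_def)
  then have "[earlier vs k e (vs e i) = earlier vs k e' (vs e i)] (mod r)"
    by (simp only: cong_add_lcancel_nat)
  then have "earlier vs k e (vs e i) = earlier vs k e' (vs e i)"
    using bound(1)[of i] bound(2)[of i'] ix eq(1) by (simp add: cong_def)
  then show False
    using assms(1) earlier_strict_mono[of e e' i k vs] earlier_strict_mono[of e' e i' k vs] ix eq(1)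
    by (metis less_irrefl linorder_neqE_nat)
qed

section \<open>Tuples indexed by base-\<open>R\<close> expansions\<close>

lemma concat_nth_blocks:
  assumes "\<And>xs. xs \<in> set xss \<Longrightarrow> length xs = l" "i < length xss" "j < l"
  shows "concat xss ! (i * l + j) = xss ! i ! j"
  using assms
proof (induction xss arbitrary: i)
  case (Cons xs xss)
  then show ?case by (cases i) (auto simp: nth_append)
qed simp

lemma length_n_lists: "length (List.n_lists k xs) = length xs ^ k"
  by (induction k) (auto simp: length_concat o_def sum_list_triv)

text \<open>As the first coordinate varies fastest, the head of tuple \<open>t\<close> is given by
  \<open>t mod R\<close> and its tail is tuple \<open>t div R\<close>. \<open>Suc\<close> appears
  because letters start at 1 and digits at 0.\<close>

lemma n_lists_nth:
  assumes "t < R ^ k"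
  shows "List.n_lists k [1..<Suc R] ! t = map (\<lambda>i. Suc (digit R t i)) [0..<k]"
  using assms
proof (induction k arbitrary: t)
  case (Suc k)
  then have "0 < R" by (cases R) auto
  have t: "t div R < R ^ k" using Suc.prems by (simp add: less_mult_imp_div_less mult.commute)
  let ?f = "\<lambda>ys. map (\<lambda>y. y # ys) [1..<Suc R]"
  have "List.n_lists (Suc k) [1..<Suc R] ! t =
      concat (map ?f (List.n_lists k [1..<Suc R])) ! (t div R * R + t mod R)"
    by simp
  also have "\<dots> = map ?f (List.n_lists k [1..<Suc R]) ! (t div R) ! (t mod R)"
    by (rule concat_nth_blocks) (use t \<open>0 < R\<close> in \<open>auto simp: length_n_lists\<close>)
  also have "\<dots> = Suc (t mod R) # map (\<lambda>i. Suc (digit R (t div R) i)) [0..<k]"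
    using t \<open>0 < R\<close> Suc.IH[OF t] by (simp add: length_n_lists del: upt_Suc)
  also have "\<dots> = map (\<lambda>i. Suc (digit R t i)) [0..<Suc k]"
    by (simp add: digit_def upt_conv_Cons map_Suc_upt[symmetric] div_mult2_eq o_def del: upt_Suc)
  finally show ?case .
qed simp

section \<open>Assignments of the constraint instance versus matchings of the hypergraph\<close>

locale csp_gadgets =
  fixes R k r :: nat and \<Phi> :: "'v csp" and \<nu> :: "'v \<Rightarrow> nat" and es :: "'v list list"
    and vs tab :: "nat \<Rightarrow> nat \<Rightarrow> nat"
  assumes prime: "prime R" and csp: "csp_instance k \<Phi>" and alph: "alph \<Phi> = R"
    and degree: "degree_bounded R \<Phi>" and pres: "csp_presentation \<nu> es \<Phi>"
    and r: "r = (if k = 0 then 0 else R)"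
    and vs: "\<And>e i. e < length es \<Longrightarrow> i < k \<Longrightarrow> vs e i = \<nu> (es ! e ! i)"
    and tab: "\<And>e t. e < length es \<Longrightarrow> t < R ^ k \<Longrightarrow> tab e t = truth_table R k (constr \<Phi> (es ! e)) ! t"
begin

abbreviation H :: "nat hypergraph" where
  "H \<equiv> hypergraph_of (r * r * card (verts \<Phi>)) (gadgets vs tab k r (length es))"

abbreviation gad :: "nat \<Rightarrow> nat \<Rightarrow> nat set" where
  "gad e t \<equiv> set (gadget vs k r e t)"

lemma r_power: "r ^ k = R ^ k"
  by (simp add: r)

lemma R_pos: "0 < R"
  using prime prime_gt_0_nat by blast

lemma prime_r: "i < k \<Longrightarrow> prime r"
  using prime by (auto simp: r)

lemma edge_in: "e < length es \<Longrightarrow> es ! e \<in> hedges \<Phi>"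
  using pres by (auto simp: csp_presentation_def)

lemma finite_hedges: "finite (hedges \<Phi>)"
  using pres by (metis csp_presentation_def List.finite_set)

lemma length_edge: "e < length es \<Longrightarrow> length (es ! e) = k"
  using csp edge_in by (auto simp: csp_instance_def)

lemma vertex_in: "e < length es \<Longrightarrow> i < k \<Longrightarrow> es ! e ! i \<in> verts \<Phi>"
  using csp edge_in[of e] length_edge[of e] unfolding csp_instance_def by (metis nth_mem subsetD)

lemma edge_eq_iff: "e < length es \<Longrightarrow> e' < length es \<Longrightarrow> es ! e = es ! e' \<longleftrightarrow> e = e'"
  using pres by (simp add: csp_presentation_def nth_eq_iff_index_eq)

lemma vs_eq_iff:
  assumes "e < length es" "i < k" "e' < length es" "i' < k"
  shows "vs e i = vs e' i' \<longleftrightarrow> es ! e ! i = es ! e' ! i'"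
proof -
  have "inj_on \<nu> (verts \<Phi>)" using pres by (auto simp: csp_presentation_def bij_betw_def)
  then show ?thesis using assms vertex_in by (simp add: vs inj_on_eq_iff)
qed

lemma vs_less: "e < length es \<Longrightarrow> i < k \<Longrightarrow> vs e i < card (verts \<Phi>)"
  using pres vertex_in[of e i] by (auto simp: vs csp_presentation_def bij_betw_def)

lemma tab_iff:
  assumes "e < length es" "t < r ^ k"
  shows "tab e t = 1 \<longleftrightarrow> map (\<lambda>i. Suc (digit r t i)) [0..<k] \<in> constr \<Phi> (es ! e)"
proof -
  have "List.n_lists k [1..<Suc R] ! t = map (\<lambda>i. Suc (digit r t i)) [0..<k]"
    using assms(2) unfolding r_power n_lists_nth by (auto simp: n_lists_nth r simp del: upt_Suc One_nat_def)
  with assms show ?thesis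
    by (simp add: tab r_power truth_table_def length_n_lists del: upt_Suc One_nat_def)
qed

text \<open>This is where the degree bound enters: \<open>e\<close> together with the earlier
  hyperedges at the vertex are distinct hyperedges through it, at most \<open>R\<close> in all.
  Counting \<open>e\<close> too makes the inequality strict.\<close>

lemma earlier_less:
  assumes e: "e < length es" and i: "i < k"
  shows "earlier vs k e (vs e i) < r"
proof -
  let ?v = "es ! e ! i"
  let ?S = "{e'. e' < e \<and> (\<exists>i'<k. vs e' i' = vs e i)}"
  have "inj_on ((!) es) (insert e ?S)"
    by (rule inj_onI) (use e edge_eq_iff in auto)
  moreover have "(!) es ` insert e ?S \<subseteq> {h \<in> hedges \<Phi>. ?v \<in> set h}"
  proof
    fix h assume "h \<in> (!) es ` insert e ?S"
    then obtain e' where S: "e' \<in> insert e ?S" "h = es ! e'" by blast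
    then have "e' < length es" "\<exists>i'<k. vs e' i' = vs e i" using e i by auto
    with S(2) obtain i' where e': "e' < length es" "i' < k" "vs e' i' = vs e i" "h = es ! e'"
      by blast
    then have "es ! e' ! i' = ?v" using vs_eq_iff e i by simp
    then have "?v \<in> set h" using e' length_edge by (metis nth_mem)
    with e' show "h \<in> {h \<in> hedges \<Phi>. ?v \<in> set h}" using edge_in by simp
  qed
  ultimately have "card (insert e ?S) \<le> card {h \<in> hedges \<Phi>. ?v \<in> set h}"
    by (rule card_inj_on_le) (use finite_hedges in simp)
  also have "\<dots> \<le> R" using degree vertex_in[OF e i] by (simp add: degree_bounded_def)
  finally show ?thesis using i by (simp add: earlier_def r)
qed

lemma hyperedge_iff:
  "h \<in> snd H \<longleftrightarrow> (\<exists>e t. e < length es \<and> t < r ^ k \<and> tab e t = 1 \<and> consistent vs k r e t \<and> h = gad e t)"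
proof -
  have "snd H = (\<Union>e<length es. gad e ` {t. t < r ^ k \<and> tab e t = 1 \<and> consistent vs k r e t})"
    by (simp add: hypergraph_of_def gadgets_def edge_gadgets_def image_UN image_image atLeast0LessThan)
  then show ?thesis by auto
qed

text \<open>Each satisfied constraint contributes the gadget of the tuple it receives under \<psi>.
  These tuples agree on common vertices, so the gadgets are disjoint.\<close>

lemma matching_of_assignment:
  assumes \<psi>: "assignment \<Phi> \<psi>"
  shows "\<exists>M. matching H M \<and> card M = card (satisfied \<Phi> \<psi>)"
proof -
  define S where "S = {e. e < length es \<and> es ! e \<in> satisfied \<Phi> \<psi>}"
  have "\<exists>t<r ^ k. map (\<lambda>i. Suc (digit r t i)) [0..<k] = map \<psi> (es ! e)" if "e \<in> S" for e
  proof -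
    have e: "e < length es" "map \<psi> (es ! e) \<in> constr \<Phi> (es ! e)"
      using that by (auto simp: S_def satisfied_def)
    then have "set (map \<psi> (es ! e)) \<subseteq> {1..R}"
      using csp edge_in[OF e(1)] alph unfolding csp_instance_def by blast
    then have "map \<psi> (es ! e) \<in> set (List.n_lists k [1..<Suc R])"
      using length_edge[OF e(1)] by (auto simp: set_n_lists)
    then obtain t where "t < R ^ k" "List.n_lists k [1..<Suc R] ! t = map \<psi> (es ! e)"
      by (auto simp: in_set_conv_nth length_n_lists simp del: upt_Suc)
    then have "map (\<lambda>i. Suc (digit R t i)) [0..<k] = map \<psi> (es ! e)"
      by (metis n_lists_nth)
    \<comment> \<open>\<open>r\<close> differs from \<open>R\<close> only for \<open>k = 0\<close>,
      where both lists are empty.\<close>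
    moreover have "map (\<lambda>i. Suc (digit R t i)) [0..<k] = map (\<lambda>i. Suc (digit r t i)) [0..<k]"
      by (auto simp: r)
    ultimately show ?thesis using \<open>t < R ^ k\<close> r_power by auto
  qed
  then obtain \<tau> where \<tau>: "\<And>e. e \<in> S \<Longrightarrow> \<tau> e < r ^ k"
    "\<And>e. e \<in> S \<Longrightarrow> map (\<lambda>i. Suc (digit r (\<tau> e) i)) [0..<k] = map \<psi> (es ! e)"
    by metis
  have digit: "Suc (digit r (\<tau> e) i) = \<psi> (es ! e ! i)" if "e \<in> S" "i < k" for e i
    using arg_cong[OF \<tau>(2)[OF that(1)], of "\<lambda>xs. xs ! i"] that length_edge by (simp add: S_def)
  let ?M = "(\<lambda>e. gad e (\<tau> e)) ` S"
  \<comment> \<open>The hyperedges may coincide here: this case gives consistency, the case of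
    distinct ones gives disjointness.\<close>
  have agree: "digit r (\<tau> e) i = digit r (\<tau> e') i'"
    if "e \<in> S" "e' \<in> S" "i < k" "i' < k" "vs e i = vs e' i'" for e e' i i'
    using that digit[of e i] digit[of e' i'] vs_eq_iff[of e i e' i'] by (simp add: S_def)
  have disj: "disjnt (gad e (\<tau> e)) (gad e' (\<tau> e'))" if "e \<in> S" "e' \<in> S" "e \<noteq> e'" for e e'
  proof (rule gadgets_disjoint[OF that(3)])
    show "digit r (\<tau> e) i = digit r (\<tau> e') i'" if "i < k" "i' < k" "vs e i = vs e' i'" for i i'
      using \<open>e \<in> S\<close> \<open>e' \<in> S\<close> that by (rule agree)
  qed (use that earlier_less in \<open>auto simp: S_def\<close>)
  have "matching H ?M"
    unfolding matching_def
  proof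
    show "?M \<subseteq> snd H"
    proof
      fix h assume "h \<in> ?M"
      then obtain e where e: "e \<in> S" "h = gad e (\<tau> e)" by blast
      moreover have "tab e (\<tau> e) = 1"
        using e \<tau> tab_iff[of e "\<tau> e"] by (simp add: S_def satisfied_def)
      moreover have "consistent vs k r e (\<tau> e)"
        using agree[OF e(1) e(1)] unfolding consistent_def by blast
      ultimately show "h \<in> snd H" unfolding hyperedge_iff using \<tau>(1) by (auto simp: S_def)
    qed
    show "pairwise disjnt ?M"
      unfolding pairwise_def using disj by auto
  qed
  moreover have "inj_on (\<lambda>e. gad e (\<tau> e)) S"
  proof (rule inj_onI, rule ccontr)
    fix e e' assume *: "e \<in> S" "e' \<in> S" "gad e (\<tau> e) = gad e' (\<tau> e')" "e \<noteq> e'"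
    \<comment> \<open>Sets both equal and disjoint are empty, which forces \<open>k = 0\<close>; but
      then both hyperedges are the empty tuple.\<close>
    with disj[of e e'] have "gad e (\<tau> e) = {}" by (simp add: disjnt_def)
    then have "k * r = 0" using length_gadget by (metis list.size(3) set_empty)
    then have "k = 0" using R_pos by (auto simp: r split: if_splits)
    then have "es ! e = es ! e'" using * length_edge by (simp add: S_def)
    then show False using * edge_eq_iff by (simp add: S_def)
  qed
  then have "card ?M = card S" by (rule card_image)
  moreover have "bij_betw ((!) es) S (satisfied \<Phi> \<psi>)"
    unfolding bij_betw_def
  proof
    show "inj_on ((!) es) S" by (rule inj_onI) (use edge_eq_iff in \<open>auto simp: S_def\<close>)
    have "set es = hedges \<Phi>" using pres by (simp add: csp_presentation_def)
    then show "(!) es ` S = satisfied \<Phi> \<psi>"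
      by (auto simp: S_def satisfied_def image_iff in_set_conv_nth) (metis in_set_conv_nth)
  qed
  then have "card S = card (satisfied \<Phi> \<psi>)" by (rule bij_betw_same_card)
  ultimately show ?thesis by metis
qed

text \<open>The tuples behind disjoint gadgets agree on common vertices, so they glue together to a
  partial assignment, and any extension of it satisfies all constraints concerned.\<close>

lemma assignment_of_matching:
  assumes M: "matching H M"
  shows "\<exists>\<psi>. assignment \<Phi> \<psi> \<and> card M \<le> card (satisfied \<Phi> \<psi>)"
proof -
  have "\<forall>h\<in>M. \<exists>e t. e < length es \<and> t < r ^ k \<and> tab e t = 1 \<and> consistent vs k r e t \<and> h = gad e t"
    using M unfolding matching_def hyperedge_iff[symmetric] by blast
  then obtain \<epsilon> \<tau> where "\<forall>h\<in>M. \<epsilon> h < length es \<and> \<tau> h < r ^ k \<and> tab (\<epsilon> h) (\<tau> h) = 1 \<and>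
      consistent vs k r (\<epsilon> h) (\<tau> h) \<and> h = gad (\<epsilon> h) (\<tau> h)"
    by metis
  then have sel: "\<And>h. h \<in> M \<Longrightarrow> \<epsilon> h < length es" "\<And>h. h \<in> M \<Longrightarrow> \<tau> h < r ^ k"
      "\<And>h. h \<in> M \<Longrightarrow> tab (\<epsilon> h) (\<tau> h) = 1" "\<And>h. h \<in> M \<Longrightarrow> consistent vs k r (\<epsilon> h) (\<tau> h)"
    and gad: "\<And>h. h \<in> M \<Longrightarrow> gad (\<epsilon> h) (\<tau> h) = h"
    by auto
  have agree: "digit r (\<tau> h) i = digit r (\<tau> h') i'"
    if "h \<in> M" "h' \<in> M" "i < k" "i' < k" "es ! \<epsilon> h ! i = es ! \<epsilon> h' ! i'" for h h' i i'
  proof (rule ccontr)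
    assume neq: "digit r (\<tau> h) i \<noteq> digit r (\<tau> h') i'"
    have v: "vs (\<epsilon> h) i = vs (\<epsilon> h') i'" using that sel vs_eq_iff by simp
    \<comment> \<open>Different values at one vertex make the two sets meet, so in a matching they
      would be the same set; consistency excludes that.\<close>
    have "\<not> disjnt h h'"
      using gadgets_meet[of r i k i' vs "\<epsilon> h" "\<epsilon> h'" "\<tau> h" "\<tau> h'", OF prime_r[OF that(3)] that(3,4) v neq] gad that(1,2) by simp
    moreover have "h \<noteq> h'"
      using sel(4)[OF that(1)] v neq that(3,4) unfolding consistent_def by blast
    ultimately show False using M that(1,2) by (auto simp: matching_def pairwise_def)
  qed
  \<comment> \<open>By \<open>agree\<close> the chosen value does not depend on the hyperedge or
    position. Other vertices get the letter 1, which belongs to every nonempty alphabet.\<close>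
  define \<psi> where "\<psi> v = (if \<exists>h\<in>M. \<exists>i<k. es ! \<epsilon> h ! i = v
    then SOME c. \<exists>h\<in>M. \<exists>i<k. es ! \<epsilon> h ! i = v \<and> c = Suc (digit r (\<tau> h) i) else 1)" for v
  have \<psi>: "\<psi> (es ! \<epsilon> h ! i) = Suc (digit r (\<tau> h) i)" if "h \<in> M" "i < k" for h i
  proof -
    have "(SOME c. \<exists>h'\<in>M. \<exists>i'<k. es ! \<epsilon> h' ! i' = es ! \<epsilon> h ! i \<and> c = Suc (digit r (\<tau> h') i')) =
        Suc (digit r (\<tau> h) i)"
      by (rule some_equality) (use that in blast, metis agree that)
    then show ?thesis using that by (auto simp: \<psi>_def)
  qed
  have "\<psi> v \<in> {1..R}" for v
  proof (cases "\<exists>h\<in>M. \<exists>i<k. es ! \<epsilon> h ! i = v")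
    case True
    then obtain h i where "i < k" "\<psi> v = Suc (digit r (\<tau> h) i)" using \<psi> by blast
    then show ?thesis using R_pos by (simp add: r digit_def Suc_leI)
  next
    case False
    then have "\<psi> v = 1" unfolding \<psi>_def by (rule if_not_P)
    then show ?thesis using R_pos by simp
  qed
  then have "assignment \<Phi> \<psi>" by (simp add: assignment_def alph)
  moreover have "card M \<le> card (satisfied \<Phi> \<psi>)"
  proof (rule card_inj_on_le)
    show "inj_on (\<lambda>h. es ! \<epsilon> h) M"
    proof (rule inj_onI)
      fix h h' assume h: "h \<in> M" "h' \<in> M" "es ! \<epsilon> h = es ! \<epsilon> h'"
      then have "\<epsilon> h = \<epsilon> h'" using edge_eq_iff sel by blast
      \<comment> \<open>A gadget depends on the tuple index only through its \<open>k\<close>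
        digits.\<close>
      moreover have "digit r (\<tau> h) i = digit r (\<tau> h') i" if "i < k" for i
        using agree[OF h(1,2) that that] h(3) by simp
      ultimately have "gad (\<epsilon> h) (\<tau> h) = gad (\<epsilon> h') (\<tau> h')"
        by (auto simp: gadget_def)
      then show "h = h'" using gad h by simp
    qed
    show "(\<lambda>h. es ! \<epsilon> h) ` M \<subseteq> satisfied \<Phi> \<psi>"
    proof
      fix f assume "f \<in> (\<lambda>h. es ! \<epsilon> h) ` M"
      then obtain h where h: "h \<in> M" "f = es ! \<epsilon> h" by blast
      have "map \<psi> f = map (\<lambda>i. Suc (digit r (\<tau> h) i)) [0..<k]"
        using h sel length_edge \<psi> by (intro nth_equalityI) auto
      then show "f \<in> satisfied \<Phi> \<psi>"
        using h sel(1-3)[OF h(1)] tab_iff[of "\<epsilon> h" "\<tau> h"] edge_in by (simp add: satisfied_def)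
    qed
    show "finite (satisfied \<Phi> \<psi>)" using finite_hedges by (simp add: satisfied_def)
  qed
  ultimately show ?thesis by blast
qed

text \<open>The two constructions above bound each optimum by the other.\<close>

lemma optimum_eq:
  assumes "optimal_assignment \<Phi> \<psi>" "maximum_matching H M"
  shows "card (satisfied \<Phi> \<psi>) = card M"
proof -
  have opt: "assignment \<Phi> \<psi>" "\<And>\<psi>'. assignment \<Phi> \<psi>' \<Longrightarrow> card (satisfied \<Phi> \<psi>') \<le> card (satisfied \<Phi> \<psi>)"
    using assms(1) by (auto simp: optimal_assignment_def is_arg_max_def not_less)
  have max: "matching H M" "\<And>M'. matching H M' \<Longrightarrow> card M' \<le> card M"
    using assms(2) by (auto simp: maximum_matching_def is_arg_max_def not_less)
  obtain M' where "matching H M'" "card M' = card (satisfied \<Phi> \<psi>)"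
    using matching_of_assignment[OF opt(1)] by blast
  moreover obtain \<psi>' where "assignment \<Phi> \<psi>'" "card M \<le> card (satisfied \<Phi> \<psi>')"
    using assignment_of_matching[OF max(1)] by blast
  ultimately show ?thesis using opt(2)[of \<psi>'] max(2)[of M'] by linarith
qed

section \<open>Sizes of hyperedges, and the partition into \<open>k * R\<close> parts\<close>

lemma set_packing: "set_packing_instance (k * R) H"
  unfolding set_packing_instance_def
proof (intro conjI ballI)
  show "finite (fst H)" by (simp add: hypergraph_of_def)
  fix h assume "h \<in> snd H"
  then obtain e t where h: "e < length es" "h = gad e t" unfolding hyperedge_iff by blast
  have "(digit r t i * x + j) mod r < r" if "i < k" for i x j
    using that R_pos by (simp add: r)
  then show "h \<subseteq> fst H"
    using h vs_less by (auto simp: set_gadget hypergraph_of_def intro!: point_less)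
  have "card h \<le> k * r" using card_length[of "gadget vs k r e t"] h by (simp add: length_gadget)
  then show "card h \<le> k * R" by (simp add: r split: if_splits)
qed

lemma dim_matching:
  assumes "partite_csp k \<Phi>"
  shows "dim_matching_instance (k * R) H"
proof -
  obtain part where part: "verts \<Phi> = (\<Union>i<k. part i)" "disjoint_family_on part {..<k}"
    "\<And>e i. e \<in> hedges \<Phi> \<Longrightarrow> i < k \<Longrightarrow> \<exists>!v. v \<in> set e \<and> v \<in> part i"
    using assms unfolding partite_csp_def partite_def by auto
  have bij: "bij_betw \<nu> (verts \<Phi>) {..<card (verts \<Phi>)}"
    using pres by (simp add: csp_presentation_def)
  \<comment> \<open>\<open>q\<close> encodes a pair: \<open>q div R\<close> is the part of the
    vertex, \<open>q mod R\<close> the first coordinate of the point.\<close>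
  define P where "P q = {point R (\<nu> v) (q mod R) y | v y. v \<in> part (q div R) \<and> y < R}" for q
  have q_div: "q div R < k" if "q < k * R" for q
    using that by (simp add: less_mult_imp_div_less)
  have r_eq: "r = R" if "q < k * R" for q
    using that by (cases k) (simp_all add: r)
  have "partite (k * R) (fst H) (snd H)"
    unfolding partite_def
  proof (rule exI[of _ P], intro conjI)
    show "fst H = (\<Union>q<k * R. P q)"
    proof
      show "fst H \<subseteq> (\<Union>q<k * R. P q)"
      proof
        fix w assume "w \<in> fst H"
        then have w: "w < r * r * card (verts \<Phi>)" by (simp add: hypergraph_of_def)
        \<comment> \<open>For \<open>k = 0\<close> also \<open>r = 0\<close>, and the hypergraph has
          no points.\<close>
        then have "k \<noteq> 0" by (intro notI) (simp add: r)
        then have rR: "r = R" by (simp add: r)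
        let ?v = "w div (R * R)" and ?x = "w mod (R * R) div R" and ?y = "w mod R"
        have "?v < card (verts \<Phi>)" using w rR by (simp add: less_mult_imp_div_less mult.commute)
        then obtain v where v: "v \<in> verts \<Phi>" "\<nu> v = ?v"
          using bij by (metis bij_betw_def imageE lessThan_iff)
        then obtain i where i: "i < k" "v \<in> part i" using part(1) by blast
        have x: "?x < R" using R_pos by (simp add: less_mult_imp_div_less)
        have "w = point R (\<nu> v) ?x ?y"
          unfolding point_def v(2)
          by (metis add.assoc mod_mod_cancel dvd_triv_left mult_div_mod_eq)
        moreover have "(i * R + ?x) div R = i" "(i * R + ?x) mod R = ?x" using x by auto
        moreover have "?y < R" using R_pos by simp
        ultimately have "w \<in> P (i * R + ?x)" unfolding P_def mem_Collect_eq using i(2) by metis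
        moreover have "i * R + ?x < k * R"
        proof -
          have "i * R + ?x < (i + 1) * R" using x by simp
          also have "\<dots> \<le> k * R" using i by (intro mult_le_mono1) simp
          finally show ?thesis .
        qed
        ultimately show "w \<in> (\<Union>q<k * R. P q)" by blast
      qed
      show "(\<Union>q<k * R. P q) \<subseteq> fst H"
      proof
        fix w assume "w \<in> (\<Union>q<k * R. P q)"
        then obtain q v y where q: "q < k * R" "w = point R (\<nu> v) (q mod R) y" "v \<in> part (q div R)" "y < R"
          by (auto simp: P_def)
        have "r = R" using q(1) by (rule r_eq)
        moreover have "v \<in> verts \<Phi>" using q(3) q_div[OF q(1)] part(1) by blast
        then have "\<nu> v < card (verts \<Phi>)" using bij bij_betwE by blast
        ultimately show "w \<in> fst H"
          using q R_pos by (auto simp: hypergraph_of_def intro!: point_less)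
      qed
    qed
    show "disjoint_family_on P {..<k * R}"
      unfolding disjoint_family_on_def
    proof (intro ballI impI, rule ccontr)
      fix q q' assume q: "q \<in> {..<k * R}" "q' \<in> {..<k * R}" "q \<noteq> q'" "P q \<inter> P q' \<noteq> {}"
      then obtain v y v' y' where v: "v \<in> part (q div R)" "v' \<in> part (q' div R)" "y < R" "y' < R"
        "point R (\<nu> v) (q mod R) y = point R (\<nu> v') (q' mod R) y'"
        by (auto simp: P_def)
      then have eq: "\<nu> v = \<nu> v'" "q mod R = q' mod R" using R_pos by (simp_all add: point_eq_iff)
      have lt: "q div R < k" "q' div R < k" using q q_div by auto
      then have "v \<in> verts \<Phi>" "v' \<in> verts \<Phi>" using v part(1) by auto
      then have "v = v'" using eq(1) bij by (auto simp: bij_betw_def inj_on_def)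
      then have "q div R = q' div R" using v part(2) lt by (auto simp: disjoint_family_on_def)
      then show False using eq(2) q(3) by (metis div_mult_mod_eq)
    qed
    show "\<forall>h\<in>snd H. \<forall>q<k * R. \<exists>!w. w \<in> h \<and> w \<in> P q"
    proof (intro ballI allI impI)
      fix h q assume "h \<in> snd H" and q: "q < k * R"
      then obtain e t where e: "e < length es" "consistent vs k r e t" "h = gad e t"
        unfolding hyperedge_iff by blast
      have rR: "r = R" using q by (rule r_eq)
      let ?x = "q mod R"
      obtain v where v: "v \<in> set (es ! e)" "v \<in> part (q div R)"
        "\<And>v'. v' \<in> set (es ! e) \<Longrightarrow> v' \<in> part (q div R) \<Longrightarrow> v' = v"
        using part(3)[OF edge_in[OF e(1)] q_div[OF q]] by auto
      obtain i where i: "i < k" "v = es ! e ! i"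
        using v(1) length_edge[OF e(1)] by (metis in_set_conv_nth)
      let ?w = "\<lambda>i x. point R (vs e i) x ((digit R t i * x + earlier vs k e (vs e i)) mod R)"
      show "\<exists>!w. w \<in> h \<and> w \<in> P q"
      proof (rule ex1I[of _ "?w i ?x"], rule conjI)
        show "?w i ?x \<in> h" unfolding e(3) set_gadget rR using i(1) mod_less_divisor[OF R_pos] by blast
        show "?w i ?x \<in> P q"
          unfolding P_def vs[OF e(1) i(1)] i(2)[symmetric] using v(2) mod_less_divisor[OF R_pos] by blast
        fix w assume "w \<in> h \<and> w \<in> P q"
        then obtain i' x' v' y where w: "w = ?w i' x'" "i' < k" "x' < R"
          "w = point R (\<nu> v') ?x y" "v' \<in> part (q div R)" "y < R"
          unfolding e(3) set_gadget rR P_def by blast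
        then have "?w i' x' = point R (\<nu> v') ?x y" by simp
        then have eq: "vs e i' = \<nu> v'" "x' = ?x"
          using w(3,6) R_pos by (simp_all add: point_eq_iff)
        have "v' \<in> verts \<Phi>" using w(5) q_div[OF q] part(1) by auto
        then have "es ! e ! i' = v'"
          using eq(1) bij vertex_in[OF e(1) w(2)] vs[OF e(1) w(2)] by (auto simp: bij_betw_def inj_on_def)
        then have "v' = v" using v(3) w(2,5) length_edge[OF e(1)] by (metis nth_mem)
        then have "vs e i' = vs e i" using eq(1) i vs[OF e(1) i(1)] by simp
        \<comment> \<open>The vertex may occur at several positions of the hyperedge; consistency
          makes the lines of these positions coincide, leaving one point above
          \<open>?x\<close>.\<close>
        then have "digit r t i' = digit r t i" using e(2) w(2) i(1) unfolding consistent_def by blast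
        then show "w = ?w i ?x" using w(1) eq(2) \<open>vs e i' = vs e i\<close> rR by simp
      qed
    qed
  qed
  with set_packing show ?thesis by (simp add: dim_matching_instance_def)
qed

end

section \<open>Access to the encoded input, and the polynomial time bound\<close>

lemma load_encode_csp:
  assumes "\<And>e. e \<in> set es \<Longrightarrow> length e = k" "alph \<Phi> = R" "e < length es" "j < k + R ^ k"
  shows "load (encode_csp k \<nu> es \<Phi>) (5 + e * (k + R ^ k) + j) =
    (map \<nu> (es ! e) @ truth_table R k (constr \<Phi> (es ! e))) ! j"
proof -
  let ?l = "k + R ^ k"
  let ?bs = "map (\<lambda>e. map \<nu> e @ truth_table R k (constr \<Phi> e)) es"
  have len: "length b = ?l" if "b \<in> set ?bs" for b
    using that assms(1) by (auto simp: truth_table_def length_n_lists simp del: upt_Suc)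
  then have "map length ?bs = map (\<lambda>_. ?l) ?bs" by (meson map_cong)
  then have "length (concat ?bs) = sum_list (map (\<lambda>_. ?l) ?bs)" by (simp only: length_concat)
  then have "length (concat ?bs) = length es * ?l" by (simp add: sum_list_triv o_def)
  moreover have "e * ?l + j < length es * ?l"
  proof -
    have "e * ?l + j < Suc e * ?l" using assms(4) by simp
    also have "\<dots> \<le> length es * ?l" using assms(3) by (intro mult_le_mono1) simp
    finally show ?thesis .
  qed
  ultimately have "load (encode_csp k \<nu> es \<Phi>) (5 + e * ?l + j) = concat ?bs ! (e * ?l + j)"
    by (simp add: load_def encode_csp_def assms(2) add.assoc)
  also have "\<dots> = ?bs ! e ! j"
    by (rule concat_nth_blocks) (use len assms in auto)
  finally show ?thesis using assms(3) by simp
qed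

lemma reduction_correct:
  fixes \<Phi> :: "nat csp"
  assumes "prime R" "csp_instance k \<Phi>" "alph \<Phi> = R" "degree_bounded R \<Phi>" "csp_presentation \<nu> es \<Phi>"
  shows "\<exists>n hs t. computes reduction_com (encode_csp k \<nu> es \<Phi>) (encode_hypergraph n hs) t \<and>
    t \<le> loop_bound (2 * (card (verts \<Phi>) + card (hedges \<Phi>) + R ^ k) ^ 2) reduction_com \<and>
    set_packing_instance (k * R) (hypergraph_of n hs) \<and>
    (\<forall>\<psi> M. optimal_assignment \<Phi> \<psi> \<and> maximum_matching (hypergraph_of n hs) M \<longrightarrow>
       card (satisfied \<Phi> \<psi>) = card M) \<and>
    (partite_csp k \<Phi> \<longrightarrow> dim_matching_instance (k * R) (hypergraph_of n hs))"
proof -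
  define inp where "inp = load (encode_csp k \<nu> es \<Phi>)"
  define r where "r = (if k = 0 then 0 else R)"
  define K where "K = card (verts \<Phi>) + card (hedges \<Phi>) + R ^ k"
  \<comment> \<open>All loop limits are at most \<open>K\<close> except
    \<open>r * r + length es\<close>, which is at most \<open>K ^ 2 + K\<close>.\<close>
  let ?L = "2 * K ^ 2"
  have "2 \<le> R" using assms(1) by (rule prime_ge_2_nat)
  have r_power: "r ^ k = R ^ k" by (simp add: r_def)
  have m: "card (hedges \<Phi>) = length es"
    using assms(5) by (metis csp_presentation_def distinct_card)
  have edges: "length e = k" if "e \<in> set es" for e
    using assms(2,5) that by (auto simp: csp_instance_def csp_presentation_def)
  have block: "inp (5 + e * (k + r ^ k) + j) = (map \<nu> (es ! e) @ truth_table R k (constr \<Phi> (es ! e))) ! j"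
    if "e < length es" "j < k + R ^ k" for e j
    using load_encode_csp[OF edges assms(3) that] by (simp add: inp_def r_power)
  have vertex: "inp (5 + e * (k + r ^ k) + i) = \<nu> (es ! e ! i)" if "e < length es" "i < k" for e i
    using block[OF that(1), of i] that edges by (simp add: nth_append)
  have K: "k \<le> K" "r \<le> K" "card (verts \<Phi>) \<le> K" "length es \<le> K" "r ^ k \<le> K"
  proof -
    \<comment> \<open>The arity is not part of the size measure, but the truth tables are at least
      exponential in it since \<open>2 \<le> R\<close>.\<close>
    have "k < 2 ^ k" by simp
    also have "\<dots> \<le> R ^ k" using \<open>2 \<le> R\<close> by (intro power_mono) auto
    finally show "k \<le> K" by (simp add: K_def)
    \<comment> \<open>Either \<open>k = 0\<close> and \<open>r = 0\<close>, or \<open>r = R\<close>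
      is at most a positive power of itself.\<close>
    have "r \<le> R ^ k" using \<open>2 \<le> R\<close> by (auto simp: r_def intro: self_le_power)
    then show "r \<le> K" by (simp add: K_def)
  qed (simp_all add: K_def m r_power)
  have KL: "K \<le> ?L"
    by (simp add: power2_eq_square)
  have "r * r \<le> K ^ 2" using K(2) by (simp add: power2_eq_square mult_le_mono)
  moreover have "K \<le> K ^ 2" by (simp add: power2_eq_square)
  ultimately have sq: "r * r + length es \<le> ?L" using K(4) by linarith
  interpret reduction_input inp k r "length es" "card (verts \<Phi>)" ?L
  proof
    show "inp 2 = k" "inp 3 = card (verts \<Phi>)" "inp 4 = length es"
      by (simp_all add: inp_def load_def encode_csp_def nth_append numeral_eq_Suc)
    show "inp 1 = r" if "0 < k"
      using that assms(3) by (simp add: inp_def load_def encode_csp_def r_def)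
    fix e i assume e: "e < length es" "i < k"
    then have "es ! e ! i \<in> verts \<Phi>"
      using assms(2,5) edges by (metis csp_instance_def csp_presentation_def nth_mem subsetD)
    then have "\<nu> (es ! e ! i) < card (verts \<Phi>)"
      using assms(5) by (auto simp: csp_presentation_def bij_betw_def)
    then show "inp (5 + e * (k + r ^ k) + i) \<le> ?L"
      using vertex[OF e] K(3) KL by linarith
  qed (use K KL sq \<open>2 \<le> R\<close> in \<open>auto simp: r_def\<close>)
  interpret csp_gadgets R k r \<Phi> \<nu> es vs tab
  proof
    show "r = (if k = 0 then 0 else R)" by (rule r_def)
    show "vs e i = \<nu> (es ! e ! i)" if "e < length es" "i < k" for e i
      using vertex[OF that] by (simp add: vs_def)
    show "tab e t = truth_table R k (constr \<Phi> (es ! e)) ! t" if "e < length es" "t < R ^ k" for e t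
      using block[OF that(1), of "k + t"] that edges by (simp add: tab_def nth_append add.assoc)
  qed (fact assms)+
  obtain t where "computes reduction_com (encode_csp k \<nu> es \<Phi>)
      (encode_hypergraph (r * r * card (verts \<Phi>)) (gadgets vs tab k r (length es))) t"
      "t \<le> loop_bound ?L reduction_com"
    using runs_reduction[OF refl] unfolding runs_def computes_def inp_def by blast
  then show ?thesis
    using set_packing optimum_eq dim_matching unfolding K_def by blast
qed

theorem theorem3p1:
  "\<exists>(P :: com) (c :: nat) (d :: nat).
     \<forall>(R :: nat) (k :: nat) (\<Phi> :: nat csp) (\<nu> :: nat \<Rightarrow> nat) (es :: nat list list).
       prime R \<and> csp_instance k \<Phi> \<and> alph \<Phi> = R \<and> degree_bounded R \<Phi> \<and>
       csp_presentation \<nu> es \<Phi> \<longrightarrow>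
       (\<exists>(n :: nat) (hs :: nat list list) (t :: nat).
          computes P (encode_csp k \<nu> es \<Phi>) (encode_hypergraph n hs) t \<and>
          t \<le> c * (card (verts \<Phi>) + card (hedges \<Phi>) + R ^ k) ^ d \<and>
          set_packing_instance (k * R) (hypergraph_of n hs) \<and>
          (\<forall>\<psi> M. optimal_assignment \<Phi> \<psi> \<and> maximum_matching (hypergraph_of n hs) M \<longrightarrow>
             card (satisfied \<Phi> \<psi>) = card M) \<and>
          (partite_csp k \<Phi> \<longrightarrow> dim_matching_instance (k * R) (hypergraph_of n hs)))"
proof -
  obtain c d where bound: "\<And>L. 1 \<le> L \<Longrightarrow> loop_bound L reduction_com \<le> c * L ^ d"
    using loop_bound_polynomial by blast
  have time: "loop_bound (2 * (V + m + R ^ k) ^ 2) reduction_com \<le> (c * 2 ^ d) * (V + m + R ^ k) ^ (2 * d)"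
    if "prime R" for V m R k :: nat
  proof -
    \<comment> \<open>The bound \<open>c * L ^ d\<close> presupposes \<open>1 \<le> L\<close>.
      Substituting \<open>L = 2 * K ^ 2\<close> gives the coefficient \<open>c * 2 ^ d\<close> and
      the exponent \<open>2 * d\<close>.\<close>
    have "1 \<le> R ^ k" using prime_gt_0_nat[OF that] by simp
    then have "1 \<le> 2 * (V + m + R ^ k) ^ 2" by simp
    from bound[OF this] show ?thesis
      by (simp add: power_mult_distrib power_mult mult.assoc)
  qed
  show ?thesis
  proof (rule exI[of _ reduction_com], rule exI[of _ "c * 2 ^ d"], rule exI[of _ "2 * d"], clarify)
    fix k and \<Phi> :: "nat csp" and \<nu> es
    assume "prime (alph \<Phi>)" "csp_instance k \<Phi>" "degree_bounded (alph \<Phi>) \<Phi>" "csp_presentation \<nu> es \<Phi>"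
    from reduction_correct[OF this(1,2) refl this(3,4)] time[OF this(1)]
    show "\<exists>n hs t. computes reduction_com (encode_csp k \<nu> es \<Phi>) (encode_hypergraph n hs) t \<and>
          t \<le> c * 2 ^ d * (card (verts \<Phi>) + card (hedges \<Phi>) + alph \<Phi> ^ k) ^ (2 * d) \<and>
          set_packing_instance (k * alph \<Phi>) (hypergraph_of n hs) \<and>
          (\<forall>\<psi> M. optimal_assignment \<Phi> \<psi> \<and> maximum_matching (hypergraph_of n hs) M \<longrightarrow>
             card (satisfied \<Phi> \<psi>) = card M) \<and>
          (partite_csp k \<Phi> \<longrightarrow> dim_matching_instance (k * alph \<Phi>) (hypergraph_of n hs))"
      by (meson le_trans)
  qed
qed

end
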